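(* There exists a constant $\theta\in(0,1)$ such that the following holds. Let $\alpha\in(0,1)$. For almost every $\omega\in\Omega^{\mathbb{N}}$ (with respect to $\mathbb{P}=\eta^\infty$) there exists $C(\omega)>0$ such that $$\|\mathcal{L}_{\omega_n}\cdots\mathcal{L}_{\omega_1}(\psi^1-\psi^2)\|_{L^1(\mathfrak{m})}\le C(\omega)\max(\|\psi^1\|_\alpha,\|\psi^2\|_\alpha)\,\theta^{\alpha n}$$ for all $n\ge0$ and all probability densities $\psi^1,\psi^2\in C^\alpha$. Moreover, given a probability distribution $d\nu=\psi\,d\mathfrak{m}$ with $\psi\in C^\alpha$, $$\left|\int f\cdot g\circ T_{\omega_n}\circ\cdots\circ T_{\omega_1}\,d\nu-\int f\,d\nu\int g\circ T_{\omega_n}\circ\cdots\circ T_{\omega_1}\,d\nu\right|\le C(\omega)\|\psi\|_\alpha\|f\|_\alpha\|g\|_\infty\,\theta^{\alpha n}$$ for all $n\ge0$ and all complex-valued functions $f\in C^\alpha$ and $g\in L^\infty$.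
   Context: Let $\mathbb{S}$ be the circle obtained by identifying the endpoints of $[0,1]$, with its usual metric $d$ and Lebesgue measure $\mathfrak{m}$. For $\alpha\in(0,1)$, $C^\alpha$ is the set of (real- or complex-valued) functions on $\mathbb{S}$ that are Hölder continuous with exponent $\alpha$; $|f|_\alpha$ is the Hölder constant and $\|f\|_\alpha=|f|_\alpha+\|f\|_\infty$. Let $(\Omega,\mathcal{F},\eta)$ be a probability space and, for each $\omega_1\in\Omega$, let $T_{\omega_1}:\mathbb{S}\to\mathbb{S}$ be a $C^2$ map without critical points ($T_{\omega_1}'\neq 0$ everywhere), such that $\Omega\times\mathbb{S}\to\mathbb{S}:(\omega_1,x)\mapsto T_{\omega_1}x$ is measurable. Put $\lambda_{\omega_1}=\inf|T_{\omega_1}'|$ and $\Delta_{\omega_1}=\|T_{\omega_1}''/(T_{\omega_1}')^2\|_\infty$, and for measurable $h:\Omega\to\mathbb{R}$ write $\langle h\rangle=\int h_{\omega_1}\,d\eta(\omega_1)$. Standing assumption: $\langle\lambda^{-2}\rangle<1$ and $\langle\Delta^2\rangle<\infty$. Sequences are written $\omega=(\omega_n)_{n\ge1}\in\Omega^{\mathbb{N}}$. The transfer operator of $T_{\omega_i}$ with respect to $\mathfrak{m}$ is $\mathcal{L}_{\omega_i}:L^1(\mathfrak{m})\to L^1(\mathfrak{m})$, $\mathcal{L}_{\omega_i}g(x)=\sum_{y\in T_{\omega_i}^{-1}\{x\}}g(y)/|T_{\omega_i}'(y)|$. Probability densities are with respect to $\mathfrak{m}$. *)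

theory Defs
  imports "HOL-Probability.Probability"
begin

text \<open>
  The circle is represented by the fundamental domain \<open>[0,1)\<close> of the reals modulo 1; \<open>frac\<close> is
  the projection from the real line. Functions on the circle are functions on the reals of which
  only the values on \<open>circle\<close> matter. The Borel sets of the circle are those of the subspace \<open>[0,1)\<close>
  of the real line.
\<close>

definition circle :: "real set" where
  "circle = {0..<1}"

definition circle_dist :: "real \<Rightarrow> real \<Rightarrow> real" where
  "circle_dist x y = min \<bar>x - y\<bar> (1 - \<bar>x - y\<bar>)"

definition circle_borel :: "real measure" where
  "circle_borel = restrict_space borel circle"

definition circle_leb :: "real measure" where
  "circle_leb = lebesgue_on circle"


definition holder :: "real \<Rightarrow> (real \<Rightarrow> 'a::real_normed_vector) \<Rightarrow> bool" where
  "holder \<alpha> f \<longleftrightarrow>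
     (\<exists>C. \<forall>x\<in>circle. \<forall>y\<in>circle. norm (f x - f y) \<le> C * circle_dist x y powr \<alpha>)"

definition holder_const :: "real \<Rightarrow> (real \<Rightarrow> 'a::real_normed_vector) \<Rightarrow> real" where
  "holder_const \<alpha> f =
     Sup {norm (f x - f y) / circle_dist x y powr \<alpha> | x y. x \<in> circle \<and> y \<in> circle \<and> x \<noteq> y}"

definition sup_norm :: "(real \<Rightarrow> 'a::real_normed_vector) \<Rightarrow> real" where
  "sup_norm f = (SUP x\<in>circle. norm (f x))"

definition holder_norm :: "real \<Rightarrow> (real \<Rightarrow> 'a::real_normed_vector) \<Rightarrow> real" where
  "holder_norm \<alpha> f = holder_const \<alpha> f + sup_norm f"

text \<open>
  The supremum norm above is only applied to continuous functions on the circle, where it agrees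
  with the essential supremum used for \<open>L\<^sup>\<infinity>\<close>.
\<close>

definition Linf :: "(real \<Rightarrow> 'a::real_normed_vector) \<Rightarrow> bool" where
  "Linf g \<longleftrightarrow> g \<in> borel_measurable circle_leb \<and>
     esssup circle_leb (\<lambda>x. ereal (norm (g x))) < \<infinity>"

definition Linf_norm :: "(real \<Rightarrow> 'a::real_normed_vector) \<Rightarrow> real" where
  "Linf_norm g = real_of_ereal (esssup circle_leb (\<lambda>x. ereal (norm (g x))))"

definition L1_norm :: "(real \<Rightarrow> 'a::real_normed_vector) \<Rightarrow> real" where
  "L1_norm g = (LINT x|circle_leb. norm (g x))"

definition prob_density :: "(real \<Rightarrow> real) \<Rightarrow> bool" where
  "prob_density \<psi> \<longleftrightarrow> (\<forall>x\<in>circle. 0 \<le> \<psi> x) \<and> integrable circle_leb \<psi> \<and>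
     (LINT x|circle_leb. \<psi> x) = 1"


text \<open>
  Smoothness and derivatives of a circle map are those of a lift to the real line. Two continuous
  lifts differ by an integer constant, so the derivatives do not depend on the lift
  (\<open>circle_deriv_eq\<close>, \<open>circle_deriv2_eq\<close> below).
\<close>

definition circle_lift :: "(real \<Rightarrow> real) \<Rightarrow> (real \<Rightarrow> real) \<Rightarrow> bool" where
  "circle_lift T F \<longleftrightarrow> continuous_on UNIV F \<and> (\<forall>x. T (frac x) = frac (F x))"

definition circle_C2 :: "(real \<Rightarrow> real) \<Rightarrow> bool" where
  "circle_C2 T \<longleftrightarrow> (\<exists>F. circle_lift T F \<and>
     (\<forall>x. F differentiable (at x)) \<and> (\<forall>x. deriv F differentiable (at x)) \<and>
     continuous_on UNIV (deriv (deriv F)))"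

definition circle_deriv :: "(real \<Rightarrow> real) \<Rightarrow> real \<Rightarrow> real" where
  "circle_deriv T = deriv (SOME F. circle_lift T F)"

definition circle_deriv2 :: "(real \<Rightarrow> real) \<Rightarrow> real \<Rightarrow> real" where
  "circle_deriv2 T = deriv (circle_deriv T)"

lemma circle_lift_unique:
  assumes "circle_lift T F" "circle_lift T G"
  shows "\<exists>k\<in>\<int>. \<forall>x. F x = G x + k"
proof -
  have int: "F x - G x \<in> \<int>" for x
  proof -
    have "frac (F x) = frac (G x)"
      using assms by (metis circle_lift_def)
    then have "F x - G x = of_int \<lfloor>F x\<rfloor> - of_int \<lfloor>G x\<rfloor>"
      by (simp add: frac_def)
    then show ?thesis by simp
  qed
  have "(\<lambda>x. F x - G x) constant_on UNIV"
  proof (rule continuous_discrete_range_constant)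
    show "connected (UNIV :: real set)" by (rule connected_UNIV)
    show "continuous_on UNIV (\<lambda>x. F x - G x)"
      using assms by (auto simp: circle_lift_def intro: continuous_on_diff)
    show "\<exists>e>0. \<forall>y. y \<in> UNIV \<and> F y - G y \<noteq> F x - G x \<longrightarrow>
        e \<le> norm ((F y - G y) - (F x - G x))" for x
    proof (intro exI[of _ 1] conjI allI impI)
      fix y assume "y \<in> UNIV \<and> F y - G y \<noteq> F x - G x"
      then have "(F y - G y) - (F x - G x) \<noteq> 0" by simp
      moreover have "(F y - G y) - (F x - G x) \<in> \<int>" by (rule Ints_diff[OF int int])
      ultimately show "1 \<le> norm ((F y - G y) - (F x - G x))"
        using Ints_nonzero_abs_ge1 by fastforce
    qed simp
  qed
  then obtain k where k: "\<And>x. F x - G x = k" by (auto simp: constant_on_def)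
  then have "k \<in> \<int>" "\<And>x. F x = G x + k" using int by (metis, smt (verit))
  then show ?thesis by blast
qed

lemma circle_deriv_eq:
  assumes "circle_lift T F"
  shows "circle_deriv T = deriv F"
proof -
  have "circle_lift T (SOME G. circle_lift T G)" using assms by (rule someI[of "circle_lift T"])
  from circle_lift_unique[OF this assms] obtain k
    where k: "\<And>x. (SOME G. circle_lift T G) x = F x + k" by blast
  have "((\<lambda>x. F x + k) has_field_derivative D) (at x) \<longleftrightarrow> (F has_field_derivative D) (at x)" for D x
    using DERIV_add[of F D x UNIV "\<lambda>_. k" 0]
      DERIV_add[of "\<lambda>x. F x + k" D x UNIV "\<lambda>_. - k" 0] by auto
  moreover have "(SOME G. circle_lift T G) = (\<lambda>x. F x + k)" using k by blast
  ultimately show ?thesis unfolding circle_deriv_def deriv_def by simp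
qed

lemma circle_deriv2_eq:
  "circle_lift T F \<Longrightarrow> circle_deriv2 T = deriv (deriv F)"
  by (simp add: circle_deriv2_def circle_deriv_eq)

definition min_expansion :: "(real \<Rightarrow> real) \<Rightarrow> real" where
  "min_expansion T = (INF x\<in>circle. \<bar>circle_deriv T x\<bar>)"

definition distortion :: "(real \<Rightarrow> real) \<Rightarrow> real" where
  "distortion T = sup_norm (\<lambda>x. circle_deriv2 T x / (circle_deriv T x)\<^sup>2)"

text \<open>
  The fibres of a \<open>C\<^sup>2\<close> circle map without critical points are finite, so the sum is a genuine one.
\<close>

definition transfer :: "(real \<Rightarrow> real) \<Rightarrow> (real \<Rightarrow> 'a::real_vector) \<Rightarrow> real \<Rightarrow> 'a" where
  "transfer T g x = (\<Sum>y | y \<in> circle \<and> T y = x. g y /\<^sub>R \<bar>circle_deriv T y\<bar>)"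

text \<open>Sequences are indexed from 1, and the factor with index 1 acts first.\<close>

primrec compose_maps :: "('w \<Rightarrow> real \<Rightarrow> real) \<Rightarrow> (nat \<Rightarrow> 'w) \<Rightarrow> nat \<Rightarrow> real \<Rightarrow> real" where
  "compose_maps T \<omega> 0 = (\<lambda>x. x)"
| "compose_maps T \<omega> (Suc n) = T (\<omega> (Suc n)) \<circ> compose_maps T \<omega> n"

primrec compose_transfer ::
  "('w \<Rightarrow> real \<Rightarrow> real) \<Rightarrow> (nat \<Rightarrow> 'w) \<Rightarrow> nat \<Rightarrow> (real \<Rightarrow> 'a::real_vector) \<Rightarrow> real \<Rightarrow> 'a" where
  "compose_transfer T \<omega> 0 g = g"
| "compose_transfer T \<omega> (Suc n) g = transfer (T (\<omega> (Suc n))) (compose_transfer T \<omega> n g)"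

end

theory Submission
  imports Defs
begin

text \<open>
  Why densities forget. A positive density whose logarithm is Lipschitz with constant \<open>K\<close> is mapped
  by the transfer operator of \<open>T\<^sub>w\<close> to one whose logarithm has constant \<open>K / \<lambda>\<^sub>w + \<Delta>\<^sub>w\<close>: inverse branches
  multiply distances by at most \<open>1 / \<lambda>\<^sub>w\<close>, and the weight of each branch has distortion \<open>\<Delta>\<^sub>w\<close> (\<open>log_lip_transfer\<close>). Such a
  density of mass \<open>m\<close> is at least \<open>m exp (- K)\<close>. Hence, of two such densities with the same mass, the
  constant \<open>d m exp (- K)\<close> can be subtracted from both; their difference is unchanged, the remaining
  mass shrinks by the factor \<open>1 - d exp (- K)\<close>, and the logarithmic Lipschitz constant grows at most by
  the factor \<open>1 / (1 - d)\<close> (\<open>log_lip_diff_const\<close>). Doing this at every step gives two scalar recursions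
  driven by the sequence of maps,

    \<open>Z\<^sub>n\<^sub>+\<^sub>1 = Z\<^sub>n / ((1 - d) \<lambda>\<^sub>n\<^sub>+\<^sub>1) + \<Delta>\<^sub>n\<^sub>+\<^sub>1\<close> and \<open>P\<^sub>n\<^sub>+\<^sub>1 = P\<^sub>n (1 - d exp (- Z\<^sub>n))\<close>,

  and the \<open>L\<^sup>1\<close> distance of the two densities at time \<open>n\<close> is at most \<open>2 P\<^sub>n\<close> (\<open>memory_loss_log_lip\<close>).

  Why the decay is exponential. For small \<open>d\<close> the recursion for \<open>Z\<close> contracts on average, so \<open>Z\<close> cannot
  stay large, and while it is bounded \<open>P\<close> loses a fixed fraction at each step. A Lyapunov function makes
  this precise: \<open>P\<^sub>n (1 + \<kappa> Z\<^sub>n)\<close> shrinks in mean by a factor \<open>\<rho> < 1\<close> at every step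
  (\<open>lyapunov_constants\<close>). The expectations of \<open>P\<^sub>n\<close> are thus summable even after division by \<open>\<rho>\<close> to the
  power \<open>n / 2\<close>, so almost surely \<open>P\<^sub>n \<le> S(\<omega>) r\<^sup>n\<close> with a fixed \<open>r < 1\<close> (\<open>AE_uncoupled_mass_decay\<close>).

  Why one \<open>C(\<omega>)\<close> serves all densities and observables. By linearity a Lipschitz function \<open>u\<close> with
  integral zero is \<open>2 L\<close> times the difference of the densities \<open>1 + u / (2 L)\<close> and \<open>1\<close>, whose logarithms
  have constant 1; the recursions always start at \<open>Z\<^sub>0 = 1\<close>, and \<open>u\<close> enters only through \<open>L\<close>. A Hoelder
  function \<open>u\<close> is replaced by its average over windows of length \<open>e = \<theta>\<^sup>n\<close>, where \<open>\<theta>\<^sup>2 = r\<close>. The average has Lipschitz constant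
  of order \<open>1 / e\<close>, so its contribution is of order \<open>P\<^sub>n / \<theta>\<^sup>n \<le> S(\<omega>) \<theta>\<^sup>n\<close>, while
  the error is of order \<open>e\<close> to the power \<open>\<alpha>\<close>. This is the rate in the theorem (\<open>memory_loss_holder\<close>).
  The first claim is the case \<open>u = \<psi>1 - \<psi>2\<close>; the second is the case of the real and imaginary parts of
  \<open>u = f \<psi> - c \<psi>\<close> with \<open>c\<close> the integral of \<open>f \<psi>\<close>, combined with the duality between composition
  and transfer.
\<close>

section \<open>The circle as a quotient of the line\<close>

lemma frac_in_circle [simp]: "frac x \<in> circle"
  by (simp add: circle_def frac_lt_1)

lemma frac_circle: "x \<in> circle \<Longrightarrow> frac x = x"
  by (simp add: circle_def frac_eq)

lemma frac_eq_frac_iff: "frac x = frac y \<longleftrightarrow> (\<exists>m::int. x = y + of_int m)"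
proof
  assume "frac x = frac y"
  then have "x = y + of_int (\<lfloor>x\<rfloor> - \<lfloor>y\<rfloor>)" by (simp add: frac_def)
  then show "\<exists>m::int. x = y + of_int m" by blast
next
  assume "\<exists>m::int. x = y + of_int m"
  then show "frac x = frac y" by (auto simp: frac_def)
qed

lemma frac_add_of_int [simp]: "frac (x + of_int m) = frac x"
  by (auto simp: frac_eq_frac_iff)

lemma frac_add_one [simp]: "frac (x + 1) = frac x"
  using frac_add_of_int[of x 1] by simp

lemma circle_dist_frac_le: "circle_dist (frac x) (frac y) \<le> \<bar>x - y\<bar>"
proof -
  define d where "d = frac x - frac y"
  define m where "m = \<lfloor>x\<rfloor> - \<lfloor>y\<rfloor>"
  have eq: "x - y = d + of_int m" by (simp add: d_def m_def frac_def)
  have d: "\<bar>d\<bar> < 1"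
    unfolding d_def using frac_ge_0[of x] frac_lt_1[of x] frac_ge_0[of y] frac_lt_1[of y] by linarith
  show ?thesis
  proof (cases "m = 0")
    case True
    then show ?thesis using eq d by (simp add: circle_dist_def d_def)
  next
    case False
    then have "1 \<le> \<bar>real_of_int m\<bar>" by linarith
    then have "1 - \<bar>d\<bar> \<le> \<bar>x - y\<bar>" using eq by linarith
    then show ?thesis by (simp add: circle_dist_def d_def)
  qed
qed

lemma abs_diff_circle: "x \<in> circle \<Longrightarrow> y \<in> circle \<Longrightarrow> \<bar>x - y\<bar> \<le> 1"
  by (auto simp: circle_def)

lemma circle_dist_nonneg: "x \<in> circle \<Longrightarrow> y \<in> circle \<Longrightarrow> 0 \<le> circle_dist x y"
  by (auto simp: circle_dist_def circle_def)

lemma periodic_add_of_int: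
  fixes q :: "real \<Rightarrow> 'a"
  assumes per: "\<And>x. q (x + 1) = q x"
  shows "q (x + of_int m) = q x"
proof (induction m rule: int_induct[where k = 0])
  case (step1 i)
  then show ?case using per[of "x + of_int i"] by (simp add: ac_simps)
next
  case (step2 i)
  then show ?case using per[of "x + of_int (i - 1)"] by (simp add: algebra_simps)
qed simp

lemma periodic_frac:
  fixes q :: "real \<Rightarrow> 'a"
  assumes per: "\<And>x. q (x + 1) = q x"
  shows "q (frac x) = q x"
  using periodic_add_of_int[of q x "- \<lfloor>x\<rfloor>", OF per] by (simp add: frac_def)

text \<open>
  The period interval \<open>{c..c+1}\<close> contains an integer; the two pieces on its sides are translated separately.
\<close>

lemma has_integral_periodic_shift:
  fixes q :: "real \<Rightarrow> 'a::banach"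
  assumes per: "\<And>x. q (x + 1) = q x" and I: "(q has_integral I) {c..c+1}"
  shows "(q has_integral I) {0..1}"
proof -
  define m where "m = \<lceil>c\<rceil>"
  have m: "c \<le> of_int m" "of_int m \<le> c + 1" unfolding m_def by linarith+
  have "q integrable_on {c..of_int m}" "q integrable_on {of_int m..c+1}"
    using I m by (auto intro: integrable_on_subinterval has_integral_integrable)
  then obtain I1 I2 where I1: "(q has_integral I1) {c..of_int m}"
    and I2: "(q has_integral I2) {of_int m..c+1}"
    by (auto simp: integrable_on_def)
  have I12: "I = I1 + I2"
    using has_integral_combine[OF m I1 I2] I has_integral_unique by blast
  have "((\<lambda>x. q (x + (-1))) has_integral I1) {c-(-1)..of_int m-(-1)}"
    using I1 by (rule has_integral_shift_real_ivl)
  moreover have "q (x + (-1)) = q x" for x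
    using per[of "x - 1"] by simp
  ultimately have "(q has_integral I1) {c+1..of_int m + 1}"
    by simp
  from has_integral_combine[OF _ _ I2 this] m have "(q has_integral I) {of_int m..of_int m+1}"
    by (simp add: I12 add.commute)
  from has_integral_shift_real_ivl[OF this, of "of_int m"] show ?thesis
    by (simp add: periodic_add_of_int[of q, OF per])
qed

lemma has_integral_fold_unit:
  fixes f :: "real \<Rightarrow> 'a::banach"
  assumes "(f has_integral I) {0..real n}"
  shows "((\<lambda>x. \<Sum>r<n. f (x + real r)) has_integral I) {0..1}"
  using assms
proof (induction n arbitrary: I)
  case 0
  then show ?case using has_integral_refl(2)[of f 0] has_integral_unique[of f I "{0..0}" 0] by auto
next
  case (Suc n)
  have "f integrable_on {0..real n}" "f integrable_on {real n..real (Suc n)}"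
    using Suc.prems by (auto intro: integrable_on_subinterval has_integral_integrable)
  then obtain I1 I2 where I1: "(f has_integral I1) {0..real n}"
    and I2: "(f has_integral I2) {real n..real (Suc n)}"
    by (auto simp: integrable_on_def)
  have I12: "I = I1 + I2"
    using has_integral_combine[OF _ _ I1 I2] Suc.prems
    by (meson has_integral_unique of_nat_0_le_iff of_nat_mono le_SucI order_refl)
  from has_integral_shift_real_ivl[OF I2, of "real n"]
  have "((\<lambda>x. f (x + real n)) has_integral I2) {0..1}" by simp
  from has_integral_add[OF Suc.IH[OF I1] this] show ?case
    by (simp add: I12)
qed

section \<open>Integration over the circle\<close>

lemma circle_sets_lebesgue: "circle \<in> sets lebesgue"
  by (simp add: circle_def)

lemma space_circle_leb [simp]: "space circle_leb = circle"
  by (simp add: circle_leb_def space_restrict_space)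

lemma prob_space_circle_leb: "prob_space circle_leb"
proof
  show "emeasure circle_leb (space circle_leb) = 1"
    by (simp add: circle_leb_def emeasure_restrict_space circle_def)
qed

interpretation circle_leb: prob_space circle_leb by (rule prob_space_circle_leb)

lemma measure_circle_leb [simp]: "measure circle_leb circle = 1"
  using circle_leb.prob_space by simp

lemma has_bochner_integral_circle:
  fixes f :: "real \<Rightarrow> real"
  assumes nn: "\<And>x. x \<in> circle \<Longrightarrow> 0 \<le> f x" and I: "((\<lambda>x. f (frac x)) has_integral I) {0..1}"
  shows "has_bochner_integral circle_leb f I"
proof -
  have "((\<lambda>x. f (frac x)) has_integral I) {0..<1}"
    by (rule has_integral_spike_set_eq[THEN iffD1, OF _ _ I]) (auto intro: negligible_subset[of "{1}"])
  then have I': "(f has_integral I) circle"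
    unfolding circle_def by (rule has_integral_eq[rotated]) (simp add: frac_eq)
  then have "f absolutely_integrable_on circle"
    using nn by (intro nonnegative_absolutely_integrable_1) (auto simp: has_integral_integrable)
  then have int: "integrable circle_leb f"
    unfolding circle_leb_def
    by (subst integrable_restrict_space) (auto simp: set_integrable_def circle_sets_lebesgue)
  then have "(LINT x|circle_leb. f x) = I"
    unfolding circle_leb_def
    by (subst lebesgue_integral_eq_integral) (use I' circle_sets_lebesgue in \<open>auto simp: circle_leb_def integral_unique\<close>)
  then show ?thesis using int by (simp add: has_bochner_integral_iff)
qed

lemma nn_integral_circle:
  fixes f :: "real \<Rightarrow> real"
  assumes nn: "\<And>x. x \<in> circle \<Longrightarrow> 0 \<le> f x" and I: "((\<lambda>x. f (frac x)) has_integral I) {0..1}"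
  shows "(\<integral>\<^sup>+ x. ennreal (f x) \<partial>circle_leb) = ennreal I"
  using has_bochner_integral_circle[OF assms] nn
  by (subst nn_integral_eq_integral) (auto simp: has_bochner_integral_iff intro!: AE_I2)

text \<open>
  Continuity of the lift to the line is continuity on the circle: it includes the point where 0 and 1
  are identified.
\<close>

definition circle_cont :: "(real \<Rightarrow> 'a::topological_space) \<Rightarrow> bool" where
  "circle_cont u \<longleftrightarrow> continuous_on UNIV (\<lambda>x. u (frac x))"

lemma circle_cont_measurable:
  fixes u :: "real \<Rightarrow> 'a::{second_countable_topology, real_normed_vector}"
  assumes "circle_cont u"
  shows "u \<in> borel_measurable circle_leb"
proof -
  have "(\<lambda>x. u (frac x)) \<in> borel_measurable borel"
    using assms unfolding circle_cont_def by (rule borel_measurable_continuous_onI)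
  then have "(\<lambda>x. u (frac x)) \<in> borel_measurable circle_leb"
    unfolding circle_leb_def by (intro measurable_restrict_space1 measurable_completion) simp
  then show ?thesis
    by (rule measurable_cong[THEN iffD1, rotated]) (simp add: frac_circle)
qed

lemma circle_cont_bounded:
  fixes u :: "real \<Rightarrow> 'a::real_normed_vector"
  assumes "circle_cont u"
  obtains B where "B > 0" "\<And>x. norm (u (frac x)) \<le> B"
proof -
  have "compact ((\<lambda>x. u (frac x)) ` {0..1})"
    using assms unfolding circle_cont_def
    by (intro compact_continuous_image compact_Icc) (auto intro: continuous_on_subset)
  then obtain B where B: "\<And>x. x \<in> {0..1} \<Longrightarrow> norm (u (frac x)) \<le> B"
    by (meson bounded_iff compact_imp_bounded image_eqI)
  have "norm (u (frac x)) \<le> B" for x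
    using B[of "frac x"] frac_lt_1[of x] by simp
  then have "max B 1 > 0" "\<And>x. norm (u (frac x)) \<le> max B 1" by (auto simp: le_max_iff_disj)
  then show thesis using that by blast
qed

lemma circle_cont_integrable:
  fixes u :: "real \<Rightarrow> 'a::{second_countable_topology, banach}"
  assumes "circle_cont u"
  shows "integrable circle_leb u"
proof -
  obtain B where "B > 0" and B: "\<And>x. norm (u (frac x)) \<le> B" using circle_cont_bounded assms by blast
  have "norm (u x) \<le> B" if "x \<in> circle" for x
    using B[of x] that by (simp add: frac_circle)
  then show ?thesis
    by (intro circle_leb.integrable_const_bound[of _ B] circle_cont_measurable[OF assms]) (auto intro!: AE_I2)
qed

section \<open>Smooth coverings of the circle and their lifts\<close>

text \<open>
  A \<open>C\<^sup>2\<close> circle map without critical points, with a chosen lift. The lift is a diffeomorphism of the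
  line, of either orientation, which makes all inverse branches values of one function.
\<close>

locale circle_covering =
  fixes T F :: "real \<Rightarrow> real"
  assumes lift: "circle_lift T F"
    and diff_F: "F differentiable (at x)"
    and diff_F': "deriv F differentiable (at x)"
    and cont_F'': "continuous_on UNIV (deriv (deriv F))"
    and no_crit_circle: "x \<in> circle \<Longrightarrow> deriv F x \<noteq> 0"
begin

lemma T_frac: "T (frac x) = frac (F x)"
  using lift by (simp add: circle_lift_def)

lemma T_in_circle: "x \<in> circle \<Longrightarrow> T x \<in> circle"
  using T_frac[of x] by (simp add: frac_circle)

lemma deriv_F: "(F has_real_derivative deriv F x) (at x)"
  using diff_F DERIV_deriv_iff_real_differentiable by blast

lemma deriv_F': "(deriv F has_real_derivative deriv (deriv F) x) (at x)"
  using diff_F' DERIV_deriv_iff_real_differentiable by blast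

lemma cont_F: "continuous_on S F"
  using deriv_F DERIV_isCont by (blast intro: continuous_at_imp_continuous_on)

lemma cont_F': "continuous_on S (deriv F)"
  using deriv_F' DERIV_isCont by (blast intro: continuous_at_imp_continuous_on)

lemma degree_exists: "\<exists>k::int. \<forall>x. F (x + 1) = F x + of_int k"
proof -
  have "circle_lift T (\<lambda>x. F (x + 1))"
    unfolding circle_lift_def
  proof safe
    show "continuous_on UNIV (\<lambda>x. F (x + 1))"
      by (rule continuous_on_compose2[OF cont_F[of UNIV]]) (auto intro: continuous_intros)
    show "T (frac x) = frac (F (x + 1))" for x
      using T_frac[of "x + 1"] by simp
  qed
  then show ?thesis using circle_lift_unique[OF _ lift] by (auto elim!: Ints_cases)
qed

definition deg :: int where "deg = (SOME k::int. \<forall>x. F (x + 1) = F x + of_int k)"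

lemma F_add_one: "F (x + 1) = F x + of_int deg"
  using someI_ex[OF degree_exists] unfolding deg_def by blast

text \<open>
  The difference between the lift and the linear map with slope \<open>deg\<close> is periodic.
\<close>

lemma F_add_of_int: "F (x + of_int m) = F x + of_int (m * deg)"
proof -
  have "F (x + of_int m) - of_int deg * (x + of_int m) = F x - of_int deg * x"
    by (rule periodic_add_of_int[of "\<lambda>x. F x - of_int deg * x"]) (simp add: F_add_one algebra_simps)
  then show ?thesis by (simp add: algebra_simps)
qed

lemma F'_add_one: "deriv F (x + 1) = deriv F x"
proof -
  have "((\<lambda>x. F (x + 1)) has_real_derivative deriv F (x + 1)) (at x)"
    using deriv_F[of "x + 1"] by (simp add: DERIV_shift)
  moreover have "((\<lambda>x. F (x + 1)) has_real_derivative deriv F x) (at x)"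
    unfolding F_add_one using DERIV_add[OF deriv_F DERIV_const] by simp
  ultimately show ?thesis by (rule DERIV_unique)
qed

lemma F''_add_one: "deriv (deriv F) (x + 1) = deriv (deriv F) x"
proof -
  have "((\<lambda>x. deriv F (x + 1)) has_real_derivative deriv (deriv F) (x + 1)) (at x)"
    using deriv_F'[of "x + 1"] by (simp add: DERIV_shift)
  then have "(deriv F has_real_derivative deriv (deriv F) (x + 1)) (at x)"
    unfolding F'_add_one .
  then show ?thesis using deriv_F' by (rule DERIV_unique)
qed

lemma F'_frac: "deriv F (frac x) = deriv F x"
  using F'_add_one by (rule periodic_frac)

lemma no_crit: "deriv F x \<noteq> 0"
  using no_crit_circle[of "frac x"] by (simp add: F'_frac)

lemma F''_frac: "deriv (deriv F) (frac x) = deriv (deriv F) x"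
  using F''_add_one by (rule periodic_frac)

lemma circle_deriv: "circle_deriv T = deriv F"
  using lift by (rule circle_deriv_eq)

lemma circle_deriv2: "circle_deriv2 T = deriv (deriv F)"
  using lift by (rule circle_deriv2_eq)

lemma min_expansion_le: "min_expansion T \<le> \<bar>deriv F x\<bar>"
proof -
  have "min_expansion T \<le> \<bar>deriv F (frac x)\<bar>"
    unfolding min_expansion_def circle_deriv
    by (rule cINF_lower) (auto intro!: bdd_belowI[of _ 0])
  then show ?thesis by (simp add: F'_frac)
qed

lemma min_expansion_pos: "0 < min_expansion T"
proof -
  have "continuous_on {0..1} (\<lambda>x. \<bar>deriv F x\<bar>)"
    by (intro continuous_intros cont_F')
  then obtain a where a: "\<forall>y\<in>{0..1}. \<bar>deriv F a\<bar> \<le> \<bar>deriv F y\<bar>"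
    using continuous_attains_inf[of "{0..1::real}" "\<lambda>x. \<bar>deriv F x\<bar>"] by auto
  have "\<bar>deriv F a\<bar> \<le> min_expansion T"
    unfolding min_expansion_def circle_deriv
    by (rule cINF_greatest) (use a in \<open>auto simp: circle_def\<close>)
  then show ?thesis using no_crit[of a] by linarith
qed

lemma distortion_ge: "\<bar>deriv (deriv F) x / (deriv F x)\<^sup>2\<bar> \<le> distortion T"
proof -
  let ?q = "\<lambda>x. norm (deriv (deriv F) x / (deriv F x)\<^sup>2)"
  have "continuous_on {0..1} ?q"
    using no_crit by (intro continuous_intros cont_F' continuous_on_subset[OF cont_F'']) auto
  then have "bdd_above (?q ` {0..1})"
    by (intro bounded_imp_bdd_above compact_imp_bounded compact_continuous_image) auto
  then have "bdd_above (?q ` circle)"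
    by (rule bdd_above_mono) (auto simp: circle_def)
  then have "?q (frac x) \<le> distortion T"
    unfolding distortion_def sup_norm_def circle_deriv circle_deriv2 by (rule cSUP_upper[rotated]) simp
  then show ?thesis by (simp add: F'_frac F''_frac)
qed

lemma distortion_nonneg: "0 \<le> distortion T"
  using distortion_ge[of 0] by linarith

lemma expansion: "min_expansion T * \<bar>x - y\<bar> \<le> \<bar>F x - F y\<bar>"
proof (induction x y rule: linorder_wlog)
  case (le x y)
  show ?case
  proof (cases "x = y")
    case False
    with le have "x < y" by simp
    then obtain z where "F y - F x = (y - x) * deriv F z"
      using MVT2[of x y F "deriv F"] deriv_F by blast
    then have "\<bar>F x - F y\<bar> = \<bar>deriv F z\<bar> * \<bar>x - y\<bar>"
      by (metis abs_minus_commute abs_mult mult.commute)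
    then show ?thesis using min_expansion_le[of z] by (simp add: mult_right_mono)
  qed simp
next
  case (sym x y)
  then show ?case by (simp add: abs_minus_commute)
qed

lemma F_inject: "F x = F y \<longleftrightarrow> x = y"
  using expansion[of x y] min_expansion_pos by (auto simp: mult_le_0_iff)

lemma deg_nonzero: "deg \<noteq> 0"
  using F_add_one[of 0] F_inject[of 1 0] by auto

text \<open>
  The values of the lift at integers are an arithmetic progression with nonzero difference, hence unbounded in
  both directions, and its range is an interval.
\<close>

lemma surj_F: "surj F"
proof -
  have "z \<in> range F" for z
  proof -
    define m where "m = sgn deg * \<lceil>\<bar>z - F 0\<bar>\<rceil>"
    have "\<lceil>\<bar>z - F 0\<bar>\<rceil> \<le> m * deg"
    proof -
      have "m * deg = \<lceil>\<bar>z - F 0\<bar>\<rceil> * \<bar>deg\<bar>" by (simp add: m_def abs_sgn)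
      moreover have "\<lceil>\<bar>z - F 0\<bar>\<rceil> * 1 \<le> \<lceil>\<bar>z - F 0\<bar>\<rceil> * \<bar>deg\<bar>"
        using deg_nonzero by (intro mult_left_mono) (auto simp: le_ceiling_iff)
      ultimately show ?thesis by simp
    qed
    then have m: "\<bar>z - F 0\<bar> \<le> of_int (m * deg)" by linarith
    have "F (of_int m) = F 0 + of_int (m * deg)" "F (of_int (- m)) = F 0 - of_int (m * deg)"
      using F_add_of_int[of 0 m] F_add_of_int[of 0 "- m"] by simp_all
    then have "F (of_int (- m)) \<le> z" "z \<le> F (of_int m)" using m by linarith+
    moreover have "is_interval (range F)"
      unfolding is_interval_connected_1
      by (intro connected_continuous_image cont_F connected_UNIV)
    ultimately show ?thesis by (meson mem_is_interval_1_I rangeI)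
  qed
  then show ?thesis by blast
qed

definition G :: "real \<Rightarrow> real" where "G = inv F"

lemma F_G [simp]: "F (G z) = z"
  using surj_F by (simp add: G_def surj_f_inv_f)

lemma G_F [simp]: "G (F x) = x"
  using F_inject F_G by blast

lemma G_add: "G (z + of_int (m * deg)) = G z + of_int m"
  by (metis F_G F_add_of_int G_F)

lemma G_contract: "\<bar>G x - G y\<bar> \<le> \<bar>x - y\<bar> / min_expansion T"
  using expansion[of "G x" "G y"] min_expansion_pos by (simp add: field_simps)

lemma deriv_G: "(G has_real_derivative inverse (deriv F (G z))) (at z)"
proof (rule DERIV_inverse_function[where f = F and a = "z - 1" and b = "z + 1"])
  show "isCont G z"
    unfolding isCont_def
  proof (rule Lim_transform_bound[where g = "\<lambda>x. \<bar>x - z\<bar> / min_expansion T", THEN Lim_null[THEN iffD2]])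
    show "\<forall>\<^sub>F x in at z. norm (G x - G z) \<le> norm (\<bar>x - z\<bar> / min_expansion T)"
      using G_contract min_expansion_pos by (auto intro!: always_eventually)
    show "((\<lambda>x. \<bar>x - z\<bar> / min_expansion T) \<longlongrightarrow> 0) (at z)"
      using min_expansion_pos by (auto intro!: tendsto_eq_intros)
  qed
qed (use deriv_F no_crit in auto)

text \<open>
  The absolute value of the derivative of \<open>G\<close>: the weight with which a point enters the transfer operator.
\<close>

definition J :: "real \<Rightarrow> real" where "J z = 1 / \<bar>deriv F (G z)\<bar>"

lemma J_pos: "0 < J z"
  using no_crit by (simp add: J_def)

lemma cont_G: "continuous_on S G"
  using deriv_G DERIV_isCont by (blast intro: continuous_at_imp_continuous_on)

lemma cont_J: "continuous_on S J"
  unfolding J_def using no_crit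
  by (intro continuous_intros continuous_on_compose2[OF cont_F'[of UNIV] cont_G]) auto

text \<open>
  The derivative of \<open>ln \<bar>F' \<circ> G\<bar>\<close> is \<open>(F'' / F'\<^sup>2) \<circ> G\<close>, which is exactly what the distortion bounds. The square
  inside the logarithm in the proof makes the computation independent of the orientation.
\<close>

lemma J_log_lipschitz: "J x \<le> exp (distortion T * \<bar>x - y\<bar>) * J y"
proof -
  define \<phi> where "\<phi> z = ln ((deriv F (G z))\<^sup>2) / 2" for z
  have J: "J z = exp (- \<phi> z)" for z
  proof -
    have "ln ((deriv F (G z))\<^sup>2) = 2 * ln \<bar>deriv F (G z)\<bar>"
      using no_crit[of "G z"] ln_realpow[of "\<bar>deriv F (G z)\<bar>" 2] by simp
    then have "\<phi> z = ln \<bar>deriv F (G z)\<bar>" by (simp add: \<phi>_def)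
    then show ?thesis using no_crit[of "G z"] by (simp add: J_def exp_minus inverse_eq_divide)
  qed
  have pos: "0 < deriv F (G z) * deriv F (G z)" for z
    by (metis no_crit not_real_square_gt_zero)
  have "(\<phi> has_real_derivative deriv (deriv F) (G z) / (deriv F (G z))\<^sup>2) (at z)" for z
    unfolding \<phi>_def
    using no_crit[of "G z"]
    by (auto intro!: derivative_eq_intros deriv_G DERIV_chain2[OF deriv_F'] pos simp: power2_eq_square field_simps)
  then have "norm (\<phi> y - \<phi> x) \<le> distortion T * norm (y - x)"
    using distortion_ge by (intro field_differentiable_bound[of UNIV]) auto
  then have "- \<phi> x \<le> distortion T * \<bar>x - y\<bar> - \<phi> y" by (auto simp: abs_minus_commute)
  then show ?thesis unfolding J by (simp add: exp_add[symmetric])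
qed

section \<open>The transfer operator of a covering\<close>

text \<open>
  The points of the fibre over \<open>x\<close> are the projections of \<open>G (x + j)\<close> for integers \<open>j\<close>. Adding a multiple of the
  degree to \<open>j\<close> moves this point by an integer, so one representative of each residue class lists the fibre once.
\<close>

lemma fibre_bij:
  "bij_betw (\<lambda>r. frac (G (x + real r))) {..<nat \<bar>deg\<bar>} {y \<in> circle. T y = frac x}"
proof (rule bij_betw_imageI)
  show "inj_on (\<lambda>r. frac (G (x + real r))) {..<nat \<bar>deg\<bar>}"
  proof (rule inj_onI)
    fix r s assume rs: "r \<in> {..<nat \<bar>deg\<bar>}" "s \<in> {..<nat \<bar>deg\<bar>}"
      and "frac (G (x + real r)) = frac (G (x + real s))"
    then obtain m :: int where "G (x + real r) = G (x + real s) + of_int m"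
      by (auto simp: frac_eq_frac_iff)
    then have "x + real r = x + real s + of_int (m * deg)"
      by (metis F_G F_add_of_int)
    then have "real_of_int (int r - int s) = real_of_int (m * deg)" by simp
    then have "int r - int s = m * deg" by (simp only: of_int_eq_iff)
    then have "deg dvd int r - int s" by simp
    then have "\<bar>deg\<bar> dvd int r - int s" by simp
    moreover have "\<bar>int r - int s\<bar> < \<bar>deg\<bar>" using rs by auto
    ultimately show "r = s" using zdvd_imp_le[of "\<bar>deg\<bar>" "\<bar>int r - int s\<bar>"] by fastforce
  qed
  show "(\<lambda>r. frac (G (x + real r))) ` {..<nat \<bar>deg\<bar>} = {y \<in> circle. T y = frac x}"
  proof safe
    fix r show "T (frac (G (x + real r))) = frac x"
      using frac_add_of_int[of x "int r"] by (simp add: T_frac)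
  next
    fix y assume y: "y \<in> circle" "T y = frac x"
    then have "frac (F y) = frac x" using T_frac[of y] by (simp add: frac_circle)
    then obtain j :: int where j: "F y = x + of_int j" by (auto simp: frac_eq_frac_iff)
    \<comment> \<open>\<open>r\<close> is the residue of \<open>j\<close>, and \<open>m\<close> is the integer with \<open>r = j + m * deg\<close> for either sign of the degree\<close>
    define r where "r = nat (j mod \<bar>deg\<bar>)"
    define m where "m = - sgn deg * (j div \<bar>deg\<bar>)"
    have r: "int r = j mod \<bar>deg\<bar>" "r < nat \<bar>deg\<bar>"
      unfolding r_def using deg_nonzero by auto
    have "m * deg = - (j div \<bar>deg\<bar> * \<bar>deg\<bar>)" by (simp add: m_def abs_sgn)
    then have "int r = j + m * deg"
      unfolding r by (simp add: minus_div_mult_eq_mod[symmetric])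
    then have "real r = of_int (j + m * deg)" by (metis of_int_of_nat_eq)
    then have "x + real r = F y + of_int (m * deg)" using j by simp
    then have "G (x + real r) = y + of_int m" using G_add[of "F y" m] by simp
    then have "frac (G (x + real r)) = y" using y by (simp add: frac_circle)
    then show "y \<in> (\<lambda>r. frac (G (x + real r))) ` {..<nat \<bar>deg\<bar>}" using r by force
  qed simp
qed

text \<open>
  Since \<open>x\<close> may be any real number, this describes the lift of the image to the line, and with it the behaviour
  of the image across the point 0 of the circle.
\<close>

lemma transfer_frac:
  fixes u :: "real \<Rightarrow> real"
  shows "transfer T u (frac x) = (\<Sum>r<nat \<bar>deg\<bar>. u (frac (G (x + real r))) * J (x + real r))"
proof -
  have "transfer T u (frac x) = (\<Sum>y\<in>{y \<in> circle. T y = frac x}. u y /\<^sub>R \<bar>circle_deriv T y\<bar>)"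
    by (simp add: transfer_def)
  also have "\<dots> = (\<Sum>r<nat \<bar>deg\<bar>. u (frac (G (x + real r))) /\<^sub>R \<bar>circle_deriv T (frac (G (x + real r)))\<bar>)"
    by (rule sum.reindex_bij_betw[OF fibre_bij, symmetric])
  finally show ?thesis by (simp add: circle_deriv F'_frac J_def divide_inverse mult.commute)
qed

lemma transfer_cont:
  fixes u :: "real \<Rightarrow> real"
  assumes "circle_cont u"
  shows "circle_cont (transfer T u)"
  using assms unfolding circle_cont_def transfer_frac
  by (intro continuous_intros continuous_on_compose2[OF assms[unfolded circle_cont_def]]
      continuous_on_compose2[OF cont_G[of UNIV]] continuous_on_compose2[OF cont_J[of UNIV]]) auto

text \<open>
  The two integrals are those of the same function over two fundamental domains. By the change of
  variables \<open>z = F x\<close>, the integral of \<open>f\<close> over \<open>{0..\<bar>deg\<bar>}\<close> becomes an integral over an interval of length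
  one, which by periodicity may be taken to be \<open>{0..1}\<close>; folding \<open>{0..\<bar>deg\<bar>}\<close> onto \<open>{0..1}\<close> instead turns the
  integrand into the sum that defines the transfer operator.
\<close>

lemma has_integral_transfer:
  fixes u :: "real \<Rightarrow> real"
  assumes u: "circle_cont u" and nn: "\<And>x. 0 \<le> u (frac x)" and A: "A \<in> sets lebesgue"
  obtains I where "((\<lambda>x. u (frac x) * indicator A (T (frac x))) has_integral I) {0..1}"
    and "((\<lambda>x. transfer T u (frac x) * indicator A (frac x)) has_integral I) {0..1}"
proof -
  let ?k = "nat \<bar>deg\<bar>"
  define f where "f z = u (frac (G z)) * J z * indicator A (frac z)" for z
  define S where "S = G ` {0..real ?k}"
  have k: "real ?k = \<bar>of_int deg\<bar>" by simp
  have FS: "F ` S = {0..real ?k}" by (simp add: S_def image_image)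
  \<comment> \<open>\<open>G\<close> moves by \<open>1\<close> or \<open>-1\<close>, according to the orientation, when its argument grows by \<open>\<bar>deg\<bar>\<close>\<close>
  have "S = closed_segment (G 0) (G (real ?k))"
    unfolding S_def using continuous_injective_image_segment_1[of 0 "real ?k" G, OF cont_G]
    by (simp add: closed_segment_eq_real_ivl) (metis F_G inj_onI)
  moreover have "G (real ?k) = G 0 + of_int (sgn deg)"
  proof -
    have "sgn deg * deg = \<bar>deg\<bar>" by (simp only: abs_sgn mult.commute)
    then have "real ?k = of_int (sgn deg * deg)" by (simp only:)
    then show ?thesis using G_add[of 0 "sgn deg"] by simp
  qed
  moreover have "sgn deg = 1 \<or> sgn deg = -1" using deg_nonzero by (auto simp: sgn_if)
  ultimately have "S = {G 0..G 0 + 1} \<or> S = {G 0 - 1..G 0 - 1 + 1}"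
    by (auto simp: closed_segment_eq_real_ivl)
  then obtain c where c: "S = {c..c+1}" by blast
  have f_nn: "0 \<le> f z" for z
    using nn J_pos[of z] by (simp add: f_def less_imp_le)
  have meas: "{z. frac z \<in> A} \<in> sets lebesgue"
  proof -
    have "{z. frac z \<in> A} = (\<Union>m. (+) (real_of_int m) ` (A \<inter> circle))"
    proof safe
      fix z assume "frac z \<in> A"
      then have "z \<in> (+) (real_of_int \<lfloor>z\<rfloor>) ` (A \<inter> circle)"
        by (intro image_eqI[of _ _ "frac z"]) (auto simp: frac_def frac_in_circle[unfolded frac_def])
      then show "z \<in> (\<Union>m. (+) (real_of_int m) ` (A \<inter> circle))" by blast
    next
      fix m z assume "z \<in> A" "z \<in> circle"
      then show "frac (real_of_int m + z) \<in> A"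
        using frac_add_of_int[of z m] by (simp add: frac_circle add.commute)
    qed
    also have "\<dots> \<in> sets lebesgue"
    proof (rule sets.countable_UN, safe)
      show "(+) (real_of_int m) ` (A \<inter> circle) \<in> sets lebesgue" for m
        by (rule lebesgue_sets_translation[OF sets.Int[OF A circle_sets_lebesgue]])
    qed
    finally show ?thesis .
  qed
  have "(\<lambda>z. u (frac (G z)) * J z) absolutely_integrable_on {0..real ?k}"
    by (intro absolutely_integrable_continuous_real continuous_intros cont_J
        continuous_on_compose2[OF u[unfolded circle_cont_def] cont_G]) auto
  then have "(\<lambda>z. u (frac (G z)) * J z) absolutely_integrable_on {0..real ?k} \<inter> {z. frac z \<in> A}"
    by (rule set_integrable_subset) (use meas in auto)
  moreover have "indicator ({0..real ?k} \<inter> {z. frac z \<in> A}) z *\<^sub>R (u (frac (G z)) * J z)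
      = indicator {0..real ?k} z *\<^sub>R f z" for z
    by (auto simp: f_def indicator_def)
  ultimately have "f absolutely_integrable_on {0..real ?k}"
    unfolding set_integrable_def by simp
  then have I: "f absolutely_integrable_on F ` S" "f integrable_on {0..real ?k}"
    by (auto simp: FS set_lebesgue_integral_eq_integral(1))
  define I where "I = integral {0..real ?k} f"
  have *: "(\<lambda>x. \<bar>deriv F x\<bar> * f (F x)) absolutely_integrable_on S \<and> integral S (\<lambda>x. \<bar>deriv F x\<bar> * f (F x)) = I"
    using I
    by (subst has_absolute_integral_change_of_variables_1')
      (auto simp: c FS I_def inj_on_def F_inject intro: has_field_derivative_at_within deriv_F, simp add: FS c[symmetric])
  have "\<bar>deriv F x\<bar> * f (F x) = u (frac x) * indicator A (T (frac x))" for x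
    using no_crit[of x] by (simp add: f_def J_def T_frac)
  with * have "((\<lambda>x. u (frac x) * indicator A (T (frac x))) has_integral I) {c..c+1}"
    unfolding c by (metis (no_types, lifting) has_integral_integral set_lebesgue_integral_eq_integral(1) ext)
  then have 1: "((\<lambda>x. u (frac x) * indicator A (T (frac x))) has_integral I) {0..1}"
    by (rule has_integral_periodic_shift[rotated]) simp
  have "(f has_integral I) {0..real ?k}"
    unfolding I_def using I by (intro integrable_integral)
  from has_integral_fold_unit[OF this]
  have "((\<lambda>x. \<Sum>r<?k. f (x + real r)) has_integral I) {0..1}" .
  moreover have "(\<Sum>r<?k. f (x + real r)) = transfer T u (frac x) * indicator A (frac x)" for x
    using frac_add_of_int[of x "int r" for r]
    by (simp add: f_def transfer_frac sum_distrib_right)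
  ultimately have 2: "((\<lambda>x. transfer T u (frac x) * indicator A (frac x)) has_integral I) {0..1}"
    by simp
  from 1 2 show thesis by (rule that)
qed

text \<open>
  With respect to the Lebesgue measurable sets on both sides, which is more than Borel measurability: it
  implies that preimages of null sets are measurable. The change of variables with \<open>u = 1\<close> provides it.
\<close>

lemma T_measurable: "T \<in> circle_leb \<rightarrow>\<^sub>M circle_leb"
proof (rule measurableI)
  fix A assume "A \<in> sets circle_leb"
  then have A: "A \<in> sets lebesgue"
    unfolding circle_leb_def using circle_sets_lebesgue by (auto simp: sets_restrict_space_iff)
  have "circle_cont (\<lambda>x. 1 :: real)" by (simp add: circle_cont_def)
  from has_integral_transfer[OF this _ A] obtain I
    where "((\<lambda>x. 1 * indicator A (T (frac x)) :: real) has_integral I) {0..1}" by auto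
  then have "has_bochner_integral circle_leb (\<lambda>x. indicator A (T x) :: real) I"
    by (intro has_bochner_integral_circle) auto
  then have "(\<lambda>x. indicator A (T x) :: real) \<in> borel_measurable circle_leb"
    by (auto simp: has_bochner_integral_iff)
  from measurable_sets[OF this, of "{1}"]
  have "(\<lambda>x. indicator A (T x) :: real) -` {1} \<inter> space circle_leb \<in> sets circle_leb" by simp
  also have "(\<lambda>x. indicator A (T x) :: real) -` {1} \<inter> space circle_leb = T -` A \<inter> space circle_leb"
    by (auto simp: indicator_def split: if_splits)
  finally show "T -` A \<inter> space circle_leb \<in> sets circle_leb" .
qed (simp add: T_in_circle)

lemma transfer_nonneg:
  fixes u :: "real \<Rightarrow> real"
  shows "(\<And>x. 0 \<le> u (frac x)) \<Longrightarrow> 0 \<le> transfer T u (frac x)"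
  by (simp add: transfer_frac sum_nonneg J_pos less_imp_le)

text \<open>
  The measure with density \<open>u\<close> is pushed forward to the measure with density \<open>transfer T u\<close>. All integral
  identities for observables, whatever their range, follow from this identity of measures.
\<close>

lemma distr_transfer:
  fixes u :: "real \<Rightarrow> real"
  assumes u: "circle_cont u" and nn: "\<And>x. 0 \<le> u (frac x)"
  shows "distr (density circle_leb u) circle_leb T = density circle_leb (transfer T u)"
proof (rule measure_eqI)
  note [measurable] = T_measurable circle_cont_measurable[OF u] circle_cont_measurable[OF transfer_cont[OF u]]
  fix A assume "A \<in> sets (distr (density circle_leb u) circle_leb T)"
  then have A[measurable]: "A \<in> sets circle_leb" by simp
  then have A': "A \<in> sets lebesgue"
    unfolding circle_leb_def using circle_sets_lebesgue by (auto simp: sets_restrict_space_iff)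
  obtain I where I: "((\<lambda>x. u (frac x) * indicator A (T (frac x))) has_integral I) {0..1}"
    "((\<lambda>x. transfer T u (frac x) * indicator A (frac x)) has_integral I) {0..1}"
    using has_integral_transfer[OF u nn A'] by blast
  have nn': "0 \<le> u x" "0 \<le> transfer T u x" if "x \<in> circle" for x
    using nn[of x] transfer_nonneg[of u x, OF nn] that by (simp_all add: frac_circle)
  have "emeasure (distr (density circle_leb u) circle_leb T) A
      = (\<integral>\<^sup>+ x. ennreal (u x) * indicator (T -` A \<inter> space circle_leb) x \<partial>circle_leb)"
    by (subst emeasure_distr) (simp_all add: emeasure_density measurable_sets[OF T_measurable A, simplified])
  also have "\<dots> = (\<integral>\<^sup>+ x. ennreal (u x * indicator A (T x)) \<partial>circle_leb)"
    by (rule nn_integral_cong) (simp split: split_indicator)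
  also have "\<dots> = ennreal I"
    by (rule nn_integral_circle[OF mult_nonneg_nonneg[OF nn'(1)] I(1)]) simp_all
  also have "\<dots> = (\<integral>\<^sup>+ x. ennreal (transfer T u x * indicator A x) \<partial>circle_leb)"
    by (rule nn_integral_circle[OF mult_nonneg_nonneg[OF nn'(2)] I(2), symmetric]) simp_all
  also have "\<dots> = (\<integral>\<^sup>+ x. ennreal (transfer T u x) * indicator A x \<partial>circle_leb)"
    by (rule nn_integral_cong) (simp split: split_indicator)
  also have "\<dots> = emeasure (density circle_leb (transfer T u)) A"
    by (simp add: emeasure_density)
  finally show "emeasure (distr (density circle_leb u) circle_leb T) A
      = emeasure (density circle_leb (transfer T u)) A" .
qed simp

end

section \<open>Densities with Lipschitz logarithm\<close>

text \<open>
  Stated for the lift, so that \<open>\<bar>x - y\<bar>\<close> bounds the circle distance and the estimate is valid across the point 0.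
\<close>

definition log_lip :: "real \<Rightarrow> (real \<Rightarrow> real) \<Rightarrow> bool" where
  "log_lip K v \<longleftrightarrow> (\<forall>x. 0 < v (frac x)) \<and> (\<forall>x y. v (frac x) \<le> exp (K * \<bar>x - y\<bar>) * v (frac y))"

lemma log_lip_pos: "log_lip K v \<Longrightarrow> 0 < v (frac x)"
  by (simp add: log_lip_def)

lemma log_lip_le: "log_lip K v \<Longrightarrow> v (frac x) \<le> exp (K * \<bar>x - y\<bar>) * v (frac y)"
  by (simp add: log_lip_def)

lemma log_lip_cont:
  assumes v: "log_lip K v"
  shows "circle_cont v"
  unfolding circle_cont_def continuous_on_eq_continuous_at[OF open_UNIV]
proof
  fix y
  show "isCont (\<lambda>x. v (frac x)) y"
    unfolding isCont_def
  proof (rule tendsto_sandwich)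
    have "exp (- (K * \<bar>x - y\<bar>)) * v (frac y) \<le> exp (- (K * \<bar>x - y\<bar>)) * (exp (K * \<bar>y - x\<bar>) * v (frac x))" for x
      by (rule mult_left_mono[OF log_lip_le[OF v]]) simp
    then show "\<forall>\<^sub>F x in at y. exp (- (K * \<bar>x - y\<bar>)) * v (frac y) \<le> v (frac x)"
      by (simp add: abs_minus_commute mult.assoc[symmetric] exp_add[symmetric])
    show "\<forall>\<^sub>F x in at y. v (frac x) \<le> exp (K * \<bar>x - y\<bar>) * v (frac y)"
      using log_lip_le[OF v] by simp
    show "((\<lambda>x. exp (- (K * \<bar>x - y\<bar>)) * v (frac y)) \<longlongrightarrow> v (frac y)) (at y)"
      by (auto intro!: tendsto_eq_intros)
    show "((\<lambda>x. exp (K * \<bar>x - y\<bar>) * v (frac y)) \<longlongrightarrow> v (frac y)) (at y)"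
      by (auto intro!: tendsto_eq_intros)
  qed
qed

text \<open>
  All values of \<open>v\<close> are comparable up to the factor \<open>exp K\<close>; averaging over one of the two points gives the bound.
\<close>

lemma log_lip_lower_bound:
  assumes v: "log_lip K v" and K: "0 \<le> K"
  shows "exp (- K) * (LINT y|circle_leb. v y) \<le> v (frac x)"
proof -
  have "exp (- K) * v y \<le> v (frac x)" if "y \<in> circle" for y
  proof -
    have "\<bar>y - frac x\<bar> \<le> 1"
      using that by (simp add: abs_diff_circle)
    then have "exp (K * \<bar>y - frac x\<bar>) \<le> exp K"
      using K by (simp add: mult_left_le)
    then have "exp (K * \<bar>y - frac x\<bar>) * v (frac x) \<le> exp K * v (frac x)"
      using log_lip_pos[OF v, of x] by (intro mult_right_mono) auto
    then have "v y \<le> exp K * v (frac x)"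
      using log_lip_le[OF v, of y "frac x"] that by (simp add: frac_circle)
    then show ?thesis by (simp add: exp_minus field_simps)
  qed
  then have "(LINT y|circle_leb. exp (- K) * v y) \<le> (LINT y|circle_leb. v (frac x))"
    using circle_cont_integrable[OF log_lip_cont[OF v]] by (intro integral_mono) auto
  then show ?thesis by simp
qed

text \<open>
  Subtracting a fraction of the density costs a factor in the constant. For \<open>c = d * v (frac y)\<close> this is the convexity
  of the exponential function; a smaller \<open>c\<close> only helps.
\<close>

lemma log_lip_diff_const:
  assumes v: "log_lip K v" and d: "0 < d" "d < 1" and c: "0 \<le> c" "\<And>x. c \<le> d * v (frac x)"
    and K: "0 \<le> K"
  shows "log_lip (K / (1 - d)) (\<lambda>x. v x - c)"
  unfolding log_lip_def
proof safe
  have lt: "c < v (frac x)" for x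
    using c(2)[of x] d log_lip_pos[OF v, of x] by (smt (verit) mult_less_cancel_right2)
  then show "0 < v (frac x) - c" for x by simp
  fix x y
  define E where "E = exp (K / (1 - d) * \<bar>x - y\<bar>)"
  have E1: "1 \<le> E" using K d by (simp add: E_def)
  \<comment> \<open>\<open>K * \<bar>x - y\<bar>\<close> lies between \<open>K / (1 - d) * \<bar>x - y\<bar>\<close> and 0, with weights \<open>1 - d\<close> and \<open>d\<close>\<close>
  have "exp ((1 - d) *\<^sub>R (K / (1 - d) * \<bar>x - y\<bar>) + d *\<^sub>R 0) \<le> (1 - d) * E + d * exp 0"
    unfolding E_def using d convex_on_exp[of 1] by (intro convex_onD[of UNIV]) auto
  then have conv: "exp (K * \<bar>x - y\<bar>) \<le> (1 - d) * E + d"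
    using d by simp
  have "v (frac x) - c \<le> ((1 - d) * E + d) * v (frac y) - c"
    using log_lip_le[OF v, of x y] mult_right_mono[OF conv, of "v (frac y)"] log_lip_pos[OF v, of y]
    by linarith
  also have "\<dots> = E * (v (frac y) - c) - (E - 1) * (d * v (frac y) - c)"
    by (simp add: algebra_simps)
  also have "\<dots> \<le> E * (v (frac y) - c)"
    using E1 c(2)[of y] by simp
  finally show "v (frac x) - c \<le> exp (K / (1 - d) * \<bar>x - y\<bar>) * (v (frac y) - c)"
    by (simp add: E_def)
qed

text \<open>
  The estimate holds branch by branch: the density is read off at two points whose distance is at most
  \<open>\<bar>x - y\<bar> / \<lambda>\<close>, and the weights contribute the distortion.
\<close>

lemma (in circle_covering) log_lip_transfer:
  assumes v: "log_lip K v" and K: "0 \<le> K"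
  shows "log_lip (K * (1 / min_expansion T) + distortion T) (transfer T v)"
  unfolding log_lip_def transfer_frac
proof safe
  show "0 < (\<Sum>r<nat \<bar>deg\<bar>. v (frac (G (x + real r))) * J (x + real r))" for x
    using deg_nonzero by (intro sum_pos mult_pos_pos log_lip_pos[OF v] J_pos) (auto simp: lessThan_empty_iff)
  fix x y
  let ?E = "exp ((K * (1 / min_expansion T) + distortion T) * \<bar>x - y\<bar>)"
  have "v (frac (G (x + real r))) * J (x + real r) \<le> ?E * (v (frac (G (y + real r))) * J (y + real r))" for r
  proof -
    let ?X = "x + real r" and ?Y = "y + real r"
    have "v (frac (G ?X)) \<le> exp (K * \<bar>G ?X - G ?Y\<bar>) * v (frac (G ?Y))"
      by (rule log_lip_le[OF v])
    also have "\<dots> \<le> exp (K * (\<bar>x - y\<bar> / min_expansion T)) * v (frac (G ?Y))"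
      using G_contract[of ?X ?Y, simplified] K log_lip_pos[OF v]
      by (intro mult_right_mono) (auto simp only: exp_le_cancel_iff less_imp_le intro!: mult_left_mono)
    finally have 1: "v (frac (G ?X)) \<le> exp (K * (\<bar>x - y\<bar> / min_expansion T)) * v (frac (G ?Y))" .
    have 2: "J ?X \<le> exp (distortion T * \<bar>x - y\<bar>) * J ?Y"
      using J_log_lipschitz[of ?X ?Y] by simp
    have "v (frac (G ?X)) * J ?X
        \<le> (exp (K * (\<bar>x - y\<bar> / min_expansion T)) * v (frac (G ?Y))) * (exp (distortion T * \<bar>x - y\<bar>) * J ?Y)"
      using log_lip_pos[OF v, of "G ?Y"] by (intro mult_mono 1 2) (auto simp: J_pos less_imp_le)
    then show ?thesis by (simp add: algebra_simps exp_add)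
  qed
  then show "(\<Sum>r<nat \<bar>deg\<bar>. v (frac (G (x + real r))) * J (x + real r))
      \<le> ?E * (\<Sum>r<nat \<bar>deg\<bar>. v (frac (G (y + real r))) * J (y + real r))"
    unfolding sum_distrib_left by (rule sum_mono)
qed

section \<open>Linearity and positivity of the transfer operator\<close>

text \<open>
  These hold for arbitrary maps, also where a fibre is infinite and the sum is 0 by convention.
\<close>

lemma transfer_diff: "transfer T (\<lambda>x. u x - v x) = (\<lambda>x. transfer T u x - transfer T v x)"
  by (simp add: transfer_def fun_eq_iff sum_subtractf scaleR_diff_right)

lemma transfer_cmult:
  fixes u :: "real \<Rightarrow> real"
  shows "transfer T (\<lambda>x. c * u x) = (\<lambda>x. c * transfer T u x)"
  by (simp add: transfer_def fun_eq_iff sum_distrib_left algebra_simps)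

lemma transfer_mono:
  fixes u :: "real \<Rightarrow> real"
  shows "(\<And>x. u x \<le> v x) \<Longrightarrow> transfer T u x \<le> transfer T v x"
  unfolding transfer_def by (intro sum_mono scaleR_left_mono) auto

lemma transfer_abs:
  fixes u :: "real \<Rightarrow> real"
  shows "\<bar>transfer T u x\<bar> \<le> transfer T (\<lambda>x. \<bar>u x\<bar>) x"
  unfolding transfer_def by (rule order_trans[OF sum_abs]) (simp add: abs_mult)

lemma compose_transfer_diff:
  "compose_transfer T \<omega> n (\<lambda>x. u x - v x) =
    (\<lambda>x. compose_transfer T \<omega> n u x - compose_transfer T \<omega> n v x)"
  by (induction n) (simp_all add: transfer_diff)

lemma compose_transfer_cmult:
  fixes u :: "real \<Rightarrow> real"
  shows "compose_transfer T \<omega> n (\<lambda>x. c * u x) = (\<lambda>x. c * compose_transfer T \<omega> n u x)"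
  by (induction n) (simp_all add: transfer_cmult)

lemma compose_transfer_abs:
  fixes u :: "real \<Rightarrow> real"
  shows "\<bar>compose_transfer T \<omega> n u x\<bar> \<le> compose_transfer T \<omega> n (\<lambda>x. \<bar>u x\<bar>) x"
proof (induction n arbitrary: x)
  case (Suc n)
  show ?case
    using order_trans[OF transfer_abs transfer_mono[OF Suc.IH]] by simp
qed simp

section \<open>Composition along a sequence of maps\<close>

locale circle_cocycle =
  fixes T :: "'w \<Rightarrow> real \<Rightarrow> real" and \<omega> :: "nat \<Rightarrow> 'w"
  assumes covering: "\<exists>F. circle_covering (T (\<omega> (Suc n))) F"
begin

lemma compose_maps_measurable: "compose_maps T \<omega> n \<in> circle_leb \<rightarrow>\<^sub>M circle_leb"
proof (induction n)
  case (Suc n)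
  obtain F where "circle_covering (T (\<omega> (Suc n))) F" using covering by blast
  then interpret circle_covering "T (\<omega> (Suc n))" F .
  show ?case using measurable_comp[OF Suc T_measurable] by (simp add: comp_def)
qed simp

lemma compose_transfer_cont:
  fixes u :: "real \<Rightarrow> real"
  assumes "circle_cont u"
  shows "circle_cont (compose_transfer T \<omega> n u)"
proof (induction n)
  case (Suc n)
  obtain F where "circle_covering (T (\<omega> (Suc n))) F" using covering by blast
  then interpret circle_covering "T (\<omega> (Suc n))" F .
  show ?case using transfer_cont[OF Suc] by simp
qed (simp add: assms)

lemma compose_transfer_nonneg:
  fixes u :: "real \<Rightarrow> real"
  assumes "\<And>x. 0 \<le> u (frac x)"
  shows "0 \<le> compose_transfer T \<omega> n u (frac x)"
proof (induction n arbitrary: x)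
  case (Suc n)
  obtain F where "circle_covering (T (\<omega> (Suc n))) F" using covering by blast
  then interpret circle_covering "T (\<omega> (Suc n))" F .
  show ?case using transfer_nonneg[of "compose_transfer T \<omega> n u" x, OF Suc] by simp
qed (simp add: assms)

lemma distr_compose_maps:
  fixes u :: "real \<Rightarrow> real"
  assumes u: "circle_cont u" and nn: "\<And>x. 0 \<le> u (frac x)"
  shows "distr (density circle_leb u) circle_leb (compose_maps T \<omega> n)
    = density circle_leb (compose_transfer T \<omega> n u)"
proof (induction n)
  case 0
  show ?case by (simp add: distr_id2)
next
  case (Suc n)
  obtain F where "circle_covering (T (\<omega> (Suc n))) F" using covering by blast
  then interpret circle_covering "T (\<omega> (Suc n))" F .
  have "distr (density circle_leb u) circle_leb (compose_maps T \<omega> (Suc n))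
      = distr (distr (density circle_leb u) circle_leb (compose_maps T \<omega> n)) circle_leb (T (\<omega> (Suc n)))"
    using compose_maps_measurable T_measurable by (subst distr_distr) auto
  then show ?case
    unfolding Suc using distr_transfer[OF compose_transfer_cont[OF u] compose_transfer_nonneg[of u n, OF nn]]
    by (simp add: comp_def)
qed

lemma duality_nonneg:
  fixes u :: "real \<Rightarrow> real" and g :: "real \<Rightarrow> 'b::{banach, second_countable_topology}"
  assumes u: "circle_cont u" and nn: "\<And>x. 0 \<le> u (frac x)" and g: "g \<in> borel_measurable circle_leb"
  shows "(LINT x|circle_leb. u x *\<^sub>R g (compose_maps T \<omega> n x))
      = (LINT x|circle_leb. compose_transfer T \<omega> n u x *\<^sub>R g x)"
    and "integrable circle_leb (\<lambda>x. u x *\<^sub>R g (compose_maps T \<omega> n x)) \<longleftrightarrow>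
      integrable circle_leb (\<lambda>x. compose_transfer T \<omega> n u x *\<^sub>R g x)"
proof -
  note [measurable] = g compose_maps_measurable[of n] circle_cont_measurable[OF u]
    circle_cont_measurable[OF compose_transfer_cont[OF u, of n]]
  have nn': "AE x in circle_leb. 0 \<le> u x" "AE x in circle_leb. 0 \<le> compose_transfer T \<omega> n u x"
    using nn[of x for x] compose_transfer_nonneg[of u n x for x, OF nn]
    by (auto intro!: AE_I2) (metis frac_circle)+
  have "(LINT x|circle_leb. u x *\<^sub>R g (compose_maps T \<omega> n x))
      = (LINT x|density circle_leb u. g (compose_maps T \<omega> n x))"
    using nn' by (subst integral_density) auto
  also have "\<dots> = (LINT x|distr (density circle_leb u) circle_leb (compose_maps T \<omega> n). g x)"
    by (subst integral_distr) auto
  also have "\<dots> = (LINT x|circle_leb. compose_transfer T \<omega> n u x *\<^sub>R g x)"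
    unfolding distr_compose_maps[OF u nn] using nn' by (subst integral_density) auto
  finally show "(LINT x|circle_leb. u x *\<^sub>R g (compose_maps T \<omega> n x))
      = (LINT x|circle_leb. compose_transfer T \<omega> n u x *\<^sub>R g x)" .
  have "integrable circle_leb (\<lambda>x. u x *\<^sub>R g (compose_maps T \<omega> n x)) \<longleftrightarrow>
      integrable (density circle_leb u) (\<lambda>x. g (compose_maps T \<omega> n x))"
    using nn' by (subst integrable_density) auto
  also have "\<dots> \<longleftrightarrow> integrable (distr (density circle_leb u) circle_leb (compose_maps T \<omega> n)) g"
    by (subst integrable_distr_eq) auto
  also have "\<dots> \<longleftrightarrow> integrable circle_leb (\<lambda>x. compose_transfer T \<omega> n u x *\<^sub>R g x)"
    unfolding distr_compose_maps[OF u nn] using nn' by (subst integrable_density) auto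
  finally show "integrable circle_leb (\<lambda>x. u x *\<^sub>R g (compose_maps T \<omega> n x)) \<longleftrightarrow>
      integrable circle_leb (\<lambda>x. compose_transfer T \<omega> n u x *\<^sub>R g x)" .
qed

lemma integral_compose_transfer_nonneg:
  fixes u :: "real \<Rightarrow> real"
  assumes "circle_cont u" "\<And>x. 0 \<le> u (frac x)"
  shows "(LINT x|circle_leb. compose_transfer T \<omega> n u x) = (LINT x|circle_leb. u x)"
  using duality_nonneg(1)[OF assms, of "\<lambda>_. 1 :: real" n] by simp

text \<open>
  Positivity reduces this to \<open>\<bar>u\<bar>\<close>, whose integral is preserved.
\<close>

lemma L1_contraction:
  fixes u :: "real \<Rightarrow> real"
  assumes u: "circle_cont u"
  shows "(LINT x|circle_leb. \<bar>compose_transfer T \<omega> n u x\<bar>) \<le> (LINT x|circle_leb. \<bar>u x\<bar>)"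
proof -
  have abs: "circle_cont (\<lambda>x. \<bar>u x\<bar>)"
    using u unfolding circle_cont_def by (intro continuous_intros)
  have "(LINT x|circle_leb. \<bar>compose_transfer T \<omega> n u x\<bar>)
      \<le> (LINT x|circle_leb. compose_transfer T \<omega> n (\<lambda>x. \<bar>u x\<bar>) x)"
    by (intro integral_mono integrable_abs circle_cont_integrable compose_transfer_cont u abs compose_transfer_abs)
  also have "\<dots> = (LINT x|circle_leb. \<bar>u x\<bar>)"
    using abs by (rule integral_compose_transfer_nonneg) simp
  finally show ?thesis .
qed

lemma integrable_cont_scaleR_AE_bounded:
  fixes u :: "real \<Rightarrow> real" and g :: "real \<Rightarrow> 'b::{banach, second_countable_topology}"
  assumes u: "circle_cont u" and g: "g \<in> borel_measurable circle_leb"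
    and M: "AE x in circle_leb. norm (g x) \<le> M"
  shows "integrable circle_leb (\<lambda>x. u x *\<^sub>R g x)"
proof -
  obtain B where B: "B > 0" "\<And>x. norm (u (frac x)) \<le> B" using circle_cont_bounded[OF u] by blast
  note [measurable] = g circle_cont_measurable[OF u]
  have "AE x in circle_leb. norm (u x *\<^sub>R g x) \<le> B * M"
    using M
  proof (rule AE_mp, intro AE_I2 impI)
    fix x assume "x \<in> space circle_leb" and gM: "norm (g x) \<le> M"
    then have "\<bar>u x\<bar> \<le> B" using B(2)[of x] by (simp add: frac_circle)
    then show "norm (u x *\<^sub>R g x) \<le> B * M" using gM B(1) by (simp add: mult_mono)
  qed
  then show ?thesis by (intro circle_leb.integrable_const_bound[of _ "B * M"]) simp_all
qed

text \<open>
  A constant added to \<open>u\<close> makes it nonnegative; the bound on \<open>g\<close> ensures that the contribution of the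
  constant is integrable and can be subtracted again.
\<close>

lemma duality:
  fixes u :: "real \<Rightarrow> real" and g :: "real \<Rightarrow> 'b::{banach, second_countable_topology}"
  assumes u: "circle_cont u" and g: "g \<in> borel_measurable circle_leb"
    and M: "AE x in circle_leb. norm (g x) \<le> M"
  shows "(LINT x|circle_leb. u x *\<^sub>R g (compose_maps T \<omega> n x))
      = (LINT x|circle_leb. compose_transfer T \<omega> n u x *\<^sub>R g x)"
    and "integrable circle_leb (\<lambda>x. u x *\<^sub>R g (compose_maps T \<omega> n x))"
proof -
  obtain B where B: "B > 0" "\<And>x. norm (u (frac x)) \<le> B" using circle_cont_bounded[OF u] by blast
  have c: "circle_cont (\<lambda>x. u x + B)" "circle_cont (\<lambda>x. B)"
    using u unfolding circle_cont_def by (auto intro!: continuous_intros)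
  have nn: "0 \<le> u (frac x) + B" "0 \<le> B" for x
    using B(2)[of x] B(1) by auto
  note int = integrable_cont_scaleR_AE_bounded[OF compose_transfer_cont[OF c(1), of n] g M]
    integrable_cont_scaleR_AE_bounded[OF compose_transfer_cont[OF c(2), of n] g M]
  note int' = duality_nonneg(2)[OF c(1) nn(1) g, THEN iffD2, OF int(1)]
    duality_nonneg(2)[OF c(2) nn(2) g, THEN iffD2, OF int(2)]
  have eq: "u x *\<^sub>R g (compose_maps T \<omega> n x)
      = (u x + B) *\<^sub>R g (compose_maps T \<omega> n x) - B *\<^sub>R g (compose_maps T \<omega> n x)" for x
    by (simp add: scaleR_left_distrib)
  show "integrable circle_leb (\<lambda>x. u x *\<^sub>R g (compose_maps T \<omega> n x))"
    unfolding eq using int' by (rule Bochner_Integration.integrable_diff)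
  have L: "compose_transfer T \<omega> n u
      = (\<lambda>x. compose_transfer T \<omega> n (\<lambda>x. u x + B) x - compose_transfer T \<omega> n (\<lambda>x. B) x)"
    unfolding compose_transfer_diff[symmetric] by simp
  show "(LINT x|circle_leb. u x *\<^sub>R g (compose_maps T \<omega> n x))
      = (LINT x|circle_leb. compose_transfer T \<omega> n u x *\<^sub>R g x)"
    unfolding eq L scaleR_diff_left
      Bochner_Integration.integral_diff[OF int] Bochner_Integration.integral_diff[OF int']
      duality_nonneg(1)[OF c(1) nn(1) g] duality_nonneg(1)[OF c(2) nn(2) g] ..
qed

end

section \<open>Coupling\<close>

text \<open>
  The recursion for the logarithmic Lipschitz constant, with \<open>a w\<close> in the role of \<open>1 / \<lambda>\<^sub>w\<close> and \<open>D w\<close> in that of \<open>\<Delta>\<^sub>w\<close>: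
  the division by \<open>1 - d\<close> pays for the constant subtracted before each map is applied. It starts at 1, the
  constant to which every initial density is normalised.
\<close>

primrec regularity :: "real \<Rightarrow> ('w \<Rightarrow> real) \<Rightarrow> ('w \<Rightarrow> real) \<Rightarrow> (nat \<Rightarrow> 'w) \<Rightarrow> nat \<Rightarrow> real" where
  "regularity d a D \<omega> 0 = 1"
| "regularity d a D \<omega> (Suc n) = regularity d a D \<omega> n / (1 - d) * a (\<omega> (Suc n)) + D (\<omega> (Suc n))"

text \<open>
  The mass left after the fraction \<open>d * exp (- Z)\<close> has been subtracted at each of the first \<open>n\<close> times.
\<close>

primrec uncoupled_mass :: "real \<Rightarrow> ('w \<Rightarrow> real) \<Rightarrow> ('w \<Rightarrow> real) \<Rightarrow> (nat \<Rightarrow> 'w) \<Rightarrow> nat \<Rightarrow> real" where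
  "uncoupled_mass d a D \<omega> 0 = 1"
| "uncoupled_mass d a D \<omega> (Suc n) = uncoupled_mass d a D \<omega> n * (1 - d * exp (- regularity d a D \<omega> n))"

lemma regularity_nonneg:
  assumes "d < 1" "\<And>i. 1 \<le> i \<Longrightarrow> i \<le> n \<Longrightarrow> 0 \<le> a (\<omega> i)" "\<And>i. 1 \<le> i \<Longrightarrow> i \<le> n \<Longrightarrow> 0 \<le> D (\<omega> i)"
  shows "0 \<le> regularity d a D \<omega> n"
  using assms by (induction n) auto

lemma coupling_fraction_le_one:
  fixes d z :: real
  assumes "0 < d" "d < 1" "0 \<le> z"
  shows "d * exp (- z) \<le> 1"
  using mult_mono[of d 1 "exp (- z)" 1] assms by simp

lemma uncoupled_mass_nonneg:
  assumes "0 < d" "d < 1" "\<And>i. 1 \<le> i \<Longrightarrow> i \<le> n \<Longrightarrow> 0 \<le> a (\<omega> i)" "\<And>i. 1 \<le> i \<Longrightarrow> i \<le> n \<Longrightarrow> 0 \<le> D (\<omega> i)"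
  shows "0 \<le> uncoupled_mass d a D \<omega> n"
  using assms
proof (induction n)
  case (Suc n)
  have "0 \<le> regularity d a D \<omega> n" using Suc.prems by (intro regularity_nonneg) auto
  then show ?case using Suc coupling_fraction_le_one[of d "regularity d a D \<omega> n"] by simp
qed simp

context circle_cocycle
begin

lemma inv_expansion_nonneg: "1 \<le> n \<Longrightarrow> 0 \<le> 1 / min_expansion (T (\<omega> n))"
  and distortion_nonneg: "1 \<le> n \<Longrightarrow> 0 \<le> distortion (T (\<omega> n))"
proof -
  assume "1 \<le> n"
  then obtain m where n: "n = Suc m" by (cases n) auto
  obtain F where "circle_covering (T (\<omega> n)) F" using covering n by blast
  then interpret circle_covering "T (\<omega> n)" F .
  show "0 \<le> 1 / min_expansion (T (\<omega> n))" "0 \<le> distortion (T (\<omega> n))"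
    using min_expansion_pos distortion_nonneg by simp_all
qed

context
  fixes d :: real
  assumes d: "0 < d" "d < 1"
begin

abbreviation "Z \<equiv> regularity d (\<lambda>w. 1 / min_expansion (T w)) (\<lambda>w. distortion (T w)) \<omega>"
abbreviation "P \<equiv> uncoupled_mass d (\<lambda>w. 1 / min_expansion (T w)) (\<lambda>w. distortion (T w)) \<omega>"

lemma Z_nonneg: "0 \<le> Z n"
  using d by (intro regularity_nonneg inv_expansion_nonneg distortion_nonneg)

lemma P_nonneg: "0 \<le> P n"
  using d by (intro uncoupled_mass_nonneg inv_expansion_nonneg distortion_nonneg)

text \<open>
  The constant that is subtracted depends on \<open>v\<close> only through its mass, so it is the same for two densities of equal
  mass. It is at most \<open>d * v\<close> by the lower bound on densities with Lipschitz logarithm.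
\<close>

lemma coupling_step:
  assumes v: "log_lip (Z n) v" and I: "(LINT x|circle_leb. v x) = P n"
  defines "w \<equiv> transfer (T (\<omega> (Suc n))) (\<lambda>x. v x - d * exp (- Z n) * P n)"
  shows "log_lip (Z (Suc n)) w" "(LINT x|circle_leb. w x) = P (Suc n)"
proof -
  obtain F where "circle_covering (T (\<omega> (Suc n))) F" using covering by blast
  then interpret circle_covering "T (\<omega> (Suc n))" F .
  define c where "c = d * exp (- Z n) * P n"
  have c: "0 \<le> c" "c \<le> d * v (frac x)" for x
    using log_lip_lower_bound[OF v Z_nonneg, of x] d P_nonneg[of n] by (auto simp: c_def I)
  have v': "log_lip (Z n / (1 - d)) (\<lambda>x. v x - c)"
    using d c Z_nonneg by (intro log_lip_diff_const[OF v]) auto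
  show "log_lip (Z (Suc n)) w"
    unfolding w_def c_def[symmetric] using log_lip_transfer[OF v'] d Z_nonneg by simp
  \<comment> \<open>preservation of the integral by a single map is that along a constant sequence after one step\<close>
  interpret single: circle_cocycle "\<lambda>_::nat. T (\<omega> (Suc n))" "\<lambda>n. n"
    by standard (use covering in blast)
  have "(LINT x|circle_leb. w x) = (LINT x|circle_leb. v x - c)"
    using single.integral_compose_transfer_nonneg[OF log_lip_cont[OF v'], of 1] log_lip_pos[OF v']
    by (simp add: w_def c_def less_imp_le)
  also have "\<dots> = P n - c"
    using circle_cont_integrable[OF log_lip_cont[OF v]]
    by (simp add: I)
  finally show "(LINT x|circle_leb. w x) = P (Suc n)"
    by (simp add: c_def algebra_simps)
qed

lemma coupling:
  assumes "log_lip 1 v1" "log_lip 1 v2" "(LINT x|circle_leb. v1 x) = 1" "(LINT x|circle_leb. v2 x) = 1"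
  shows "\<exists>w1 w2. log_lip (Z n) w1 \<and> log_lip (Z n) w2 \<and>
    (LINT x|circle_leb. w1 x) = P n \<and> (LINT x|circle_leb. w2 x) = P n \<and>
    compose_transfer T \<omega> n (\<lambda>x. v1 x - v2 x) = (\<lambda>x. w1 x - w2 x)"
proof (induction n)
  case 0
  then show ?case using assms by auto
next
  case (Suc n)
  then obtain w1 w2 where w: "log_lip (Z n) w1" "log_lip (Z n) w2"
    "(LINT x|circle_leb. w1 x) = P n" "(LINT x|circle_leb. w2 x) = P n"
    "compose_transfer T \<omega> n (\<lambda>x. v1 x - v2 x) = (\<lambda>x. w1 x - w2 x)" by blast
  have "compose_transfer T \<omega> (Suc n) (\<lambda>x. v1 x - v2 x) =
    transfer (T (\<omega> (Suc n))) (\<lambda>x. (w1 x - d * exp (- Z n) * P n) - (w2 x - d * exp (- Z n) * P n))"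
    using w(5) by simp
  also have "\<dots> = (\<lambda>x. transfer (T (\<omega> (Suc n))) (\<lambda>x. w1 x - d * exp (- Z n) * P n) x
      - transfer (T (\<omega> (Suc n))) (\<lambda>x. w2 x - d * exp (- Z n) * P n) x)"
    by (rule transfer_diff)
  finally show ?case
    using coupling_step[OF w(1,3)] coupling_step[OF w(2,4)] by blast
qed

lemma memory_loss_log_lip:
  assumes "log_lip 1 v1" "log_lip 1 v2" "(LINT x|circle_leb. v1 x) = 1" "(LINT x|circle_leb. v2 x) = 1"
  shows "(LINT x|circle_leb. \<bar>compose_transfer T \<omega> n (\<lambda>x. v1 x - v2 x) x\<bar>) \<le> 2 * P n"
proof -
  obtain w1 w2 where w: "log_lip (Z n) w1" "log_lip (Z n) w2"
    "(LINT x|circle_leb. w1 x) = P n" "(LINT x|circle_leb. w2 x) = P n"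
    "compose_transfer T \<omega> n (\<lambda>x. v1 x - v2 x) = (\<lambda>x. w1 x - w2 x)" using coupling[OF assms] by blast
  note int = circle_cont_integrable[OF log_lip_cont[OF w(1)]] circle_cont_integrable[OF log_lip_cont[OF w(2)]]
  have "(LINT x|circle_leb. \<bar>w1 x - w2 x\<bar>) \<le> (LINT x|circle_leb. w1 x + w2 x)"
  proof (intro integral_mono Bochner_Integration.integrable_add integrable_abs Bochner_Integration.integrable_diff int)
    fix x assume "x \<in> space circle_leb"
    then show "\<bar>w1 x - w2 x\<bar> \<le> w1 x + w2 x"
      using log_lip_pos[OF w(1), of x] log_lip_pos[OF w(2), of x] by (simp add: frac_circle)
  qed
  then show ?thesis using int w(3,4) by (simp add: w(5))
qed

text \<open>
  After division by \<open>2 * L\<close> the function is at least \<open>- 1 / 2\<close> and has Lipschitz constant \<open>1 / 2\<close>, so adding 1 gives a density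
  with values at least \<open>1 / 2\<close> whose logarithm has constant 1. It is compared with the constant density 1.
\<close>

lemma memory_loss_lipschitz:
  assumes L: "L > 0" and u: "\<And>x y. \<bar>u (frac x) - u (frac y)\<bar> \<le> L * \<bar>x - y\<bar>"
    and cont: "circle_cont u" and I: "(LINT x|circle_leb. u x) = 0"
  shows "(LINT x|circle_leb. \<bar>compose_transfer T \<omega> n u x\<bar>) \<le> 4 * L * P n"
proof -
  have int: "integrable circle_leb u" by (rule circle_cont_integrable[OF cont])
  have lower: "- L \<le> u (frac x)" for x
  proof -
    \<comment> \<open>a function with integral zero whose oscillation is at most \<open>L\<close> is at least \<open>- L\<close>\<close>
    have "u y - L \<le> u (frac x)" if "y \<in> circle" for y
    proof -
      have "L * \<bar>y - frac x\<bar> \<le> L * 1"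
        using that L by (intro mult_left_mono) (auto simp: abs_diff_circle)
      then show ?thesis using u[of y "frac x"] that by (simp add: frac_circle)
    qed
    then have "(LINT y|circle_leb. u y - L) \<le> (LINT y|circle_leb. u (frac x))"
      using int by (intro integral_mono) auto
    then show ?thesis using int by (simp add: I)
  qed
  define v where "v x = 1 + u x / (2 * L)" for x
  have half: "1 / 2 \<le> v (frac x)" for x
    using lower[of x] L by (simp add: v_def field_simps)
  have "log_lip 1 v"
    unfolding log_lip_def
  proof safe
    show "0 < v (frac x)" for x using half[of x] by linarith
    fix x y
    have "v (frac x) - v (frac y) = (u (frac x) - u (frac y)) / (2 * L)"
      by (simp add: v_def diff_divide_distrib)
    also have "\<dots> \<le> (L * \<bar>x - y\<bar>) / (2 * L)"
      using u[of x y] L by (intro divide_right_mono) auto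
    also have "\<dots> = \<bar>x - y\<bar> * (1 / 2)" using L by simp
    also have "\<dots> \<le> \<bar>x - y\<bar> * v (frac y)" using half[of y] by (intro mult_left_mono) auto
    finally have "v (frac x) \<le> (1 + \<bar>x - y\<bar>) * v (frac y)" by (simp add: algebra_simps)
    also have "\<dots> \<le> exp \<bar>x - y\<bar> * v (frac y)"
      using half[of y] by (intro mult_right_mono) auto
    finally show "v (frac x) \<le> exp (1 * \<bar>x - y\<bar>) * v (frac y)" by simp
  qed
  moreover have "log_lip 1 (\<lambda>_. 1)" by (simp add: log_lip_def)
  moreover have "(LINT x|circle_leb. v x) = 1" unfolding v_def using int by (simp add: I)
  ultimately have *: "(LINT x|circle_leb. \<bar>compose_transfer T \<omega> n (\<lambda>x. v x - 1) x\<bar>) \<le> 2 * P n"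
    by (intro memory_loss_log_lip) auto
  have "u = (\<lambda>x. (2 * L) * (v x - 1))" using L by (simp add: v_def fun_eq_iff)
  then have "compose_transfer T \<omega> n u x = (2 * L) * compose_transfer T \<omega> n (\<lambda>x. v x - 1) x" for x
    using compose_transfer_cmult[of T \<omega> n "2 * L" "\<lambda>x. v x - 1"] by metis
  then have "(LINT x|circle_leb. \<bar>compose_transfer T \<omega> n u x\<bar>)
      = (2 * L) * (LINT x|circle_leb. \<bar>compose_transfer T \<omega> n (\<lambda>x. v x - 1) x\<bar>)"
    using L by (simp add: abs_mult)
  also have "\<dots> \<le> (2 * L) * (2 * P n)" using * L by (intro mult_left_mono) auto
  finally show ?thesis by simp
qed

end
end

section \<open>Hoelder functions and their mollification\<close>

lemma holder_bound:
  assumes f: "holder \<alpha> f" and xy: "x \<in> circle" "y \<in> circle"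
  shows "norm (f x - f y) \<le> holder_const \<alpha> f * circle_dist x y powr \<alpha>"
proof (cases "x = y")
  case False
  let ?S = "{norm (f x - f y) / circle_dist x y powr \<alpha> | x y. x \<in> circle \<and> y \<in> circle \<and> x \<noteq> y}"
  have pos: "0 < circle_dist x y powr \<alpha>" if "x \<in> circle" "y \<in> circle" "x \<noteq> y" for x y
    using that by (auto simp: circle_dist_def circle_def)
  obtain C where C: "\<forall>x\<in>circle. \<forall>y\<in>circle. norm (f x - f y) \<le> C * circle_dist x y powr \<alpha>"
    using f unfolding holder_def by blast
  have "bdd_above ?S"
    using C pos by (intro bdd_aboveI[of _ C]) (auto simp: divide_le_eq)
  then have "norm (f x - f y) / circle_dist x y powr \<alpha> \<le> holder_const \<alpha> f"
    unfolding holder_const_def using xy False by (intro cSup_upper) auto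
  then show ?thesis using pos[OF xy False] by (simp add: divide_le_eq)
qed (simp add: circle_dist_def)

lemma holder_const_nonneg:
  assumes f: "holder \<alpha> f"
  shows "0 \<le> holder_const \<alpha> f"
proof -
  have "norm (f 0 - f (1/2)) \<le> holder_const \<alpha> f * circle_dist 0 (1/2) powr \<alpha>"
    by (rule holder_bound[OF f]) (simp_all add: circle_def)
  then have "0 \<le> holder_const \<alpha> f * circle_dist 0 (1/2) powr \<alpha>"
    using norm_ge_zero order_trans by blast
  then show ?thesis by (simp add: circle_dist_def zero_le_mult_iff)
qed

lemma holder_bound_lift:
  assumes f: "holder \<alpha> f" and \<alpha>: "0 < \<alpha>"
  shows "norm (f (frac x) - f (frac y)) \<le> holder_const \<alpha> f * \<bar>x - y\<bar> powr \<alpha>"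
proof -
  have "circle_dist (frac x) (frac y) powr \<alpha> \<le> \<bar>x - y\<bar> powr \<alpha>"
    using \<alpha> by (intro powr_mono2 circle_dist_frac_le circle_dist_nonneg) auto
  then show ?thesis
    using holder_bound[OF f, of "frac x" "frac y"] holder_const_nonneg[OF f]
    by (meson frac_in_circle mult_left_mono order_trans)
qed

lemma circle_cont_of_modulus:
  fixes f :: "real \<Rightarrow> 'a::real_normed_vector"
  assumes f: "\<And>x y. norm (f (frac x) - f (frac y)) \<le> H * \<bar>x - y\<bar> powr \<alpha>" and \<alpha>: "0 < \<alpha>"
  shows "circle_cont f"
  unfolding circle_cont_def continuous_on_eq_continuous_at[OF open_UNIV]
proof
  fix y
  have "((\<lambda>x. H * \<bar>x - y\<bar> powr \<alpha>) \<longlongrightarrow> 0) (at y)"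
  proof -
    have "((\<lambda>x. \<bar>x - y\<bar> powr \<alpha>) \<longlongrightarrow> 0) (at y)"
      using \<alpha> by (intro tendsto_zero_powrI[where b = \<alpha>]) (auto intro!: tendsto_eq_intros)
    from tendsto_mult_right_zero[OF this] show ?thesis .
  qed
  then have "((\<lambda>x. f (frac x) - f (frac y)) \<longlongrightarrow> 0) (at y)"
    by (rule Lim_null_comparison[rotated]) (use f in auto)
  then show "isCont (\<lambda>x. f (frac x)) y"
    unfolding isCont_def by (rule Lim_null[THEN iffD2])
qed

lemma holder_cont: "holder \<alpha> f \<Longrightarrow> 0 < \<alpha> \<Longrightarrow> circle_cont f"
  using circle_cont_of_modulus holder_bound_lift by blast

lemma norm_le_sup_norm:
  assumes "circle_cont f"
  shows "norm (f (frac x)) \<le> sup_norm f"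
proof -
  obtain B where B: "\<And>x. norm (f (frac x)) \<le> B" using circle_cont_bounded[OF assms] by blast
  have "bdd_above ((\<lambda>x. norm (f x)) ` circle)"
  proof (rule bdd_aboveI2)
    show "norm (f y) \<le> B" if "y \<in> circle" for y
      using B[of y] that by (simp add: frac_circle)
  qed
  then show ?thesis unfolding sup_norm_def by (rule cSUP_upper[rotated]) simp
qed

text \<open>
  The integrand is a function on the line, not composed with the projection; on the circle the two agree.
\<close>

lemma integral_circle_FTC:
  fixes V q :: "real \<Rightarrow> real"
  assumes V: "\<And>x. (V has_real_derivative q x) (at x)" and q: "continuous_on UNIV q"
  shows "(LINT x|circle_leb. q x) = V 1 - V 0"
proof -
  have "(q has_integral V 1 - V 0) {0..1}"
    using V by (intro fundamental_theorem_of_calculus)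
      (auto simp: has_real_derivative_iff_has_vector_derivative[symmetric] intro: has_field_derivative_at_within)
  then have I: "(q has_integral V 1 - V 0) circle"
    unfolding circle_def
    by (rule has_integral_spike_set_eq[THEN iffD1, rotated 2]) (auto intro: negligible_subset[of "{1}"])
  have "q absolutely_integrable_on {0..1}"
    by (intro absolutely_integrable_continuous_real continuous_on_subset[OF q]) auto
  then have "q absolutely_integrable_on circle"
    by (rule set_integrable_subset) (auto simp: circle_def)
  then have "integrable circle_leb q"
    unfolding circle_leb_def
    by (subst integrable_restrict_space) (auto simp: set_integrable_def circle_sets_lebesgue)
  then show ?thesis
    unfolding circle_leb_def
    by (subst lebesgue_integral_eq_integral) (use I circle_sets_lebesgue in \<open>auto simp: circle_leb_def integral_unique\<close>)
qed

lemma antiderivative_real: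
  fixes q :: "real \<Rightarrow> real"
  assumes "continuous_on UNIV q"
  obtains V where "\<And>x. (V has_real_derivative q x) (at x)"
proof -
  have "\<exists>V. \<forall>x :: real. -\<infinity> < ereal x \<longrightarrow> ereal x < \<infinity> \<longrightarrow> (V has_vector_derivative q x) (at x)"
    using assms by (intro einterval_antiderivative) (auto simp: continuous_on_eq_continuous_at)
  then show thesis using that by (auto simp: has_real_derivative_iff_has_vector_derivative)
qed

lemma shift_increment_constant:
  fixes V q :: "real \<Rightarrow> real"
  assumes V: "\<And>x. (V has_real_derivative q x) (at x)" and q: "\<And>x. q (x + 1) = q x"
  shows "V (x + 1) - V x = V 1 - V 0"
proof -
  have "((\<lambda>x. V (x + 1) - V x) has_real_derivative 0) (at x)" for x
  proof -
    have "((\<lambda>x. V (x + 1)) has_real_derivative q x) (at x)"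
      using V[of "x + 1"] by (simp add: DERIV_shift q)
    from DERIV_diff[OF this V[of x]] show ?thesis by simp
  qed
  then have "(\<lambda>x. V (x + 1) - V x) x = (\<lambda>x. V (x + 1) - V x) 0"
    by (intro DERIV_isconst_all) auto
  then show ?thesis by simp
qed

text \<open>
  The mollification is the average of \<open>u\<close> over \<open>{x..x + e}\<close>, written as a difference quotient of an
  antiderivative \<open>U\<close> of the lift. In this form the Lipschitz constant comes from that of \<open>U\<close>, the approximation from the mean value
  theorem, and the vanishing integral from a second antiderivative. The hypothesis that \<open>u\<close> has integral zero
  makes \<open>U\<close> periodic.
\<close>

lemma mollify:
  fixes u :: "real \<Rightarrow> real"
  assumes u: "\<And>x y. \<bar>u (frac x) - u (frac y)\<bar> \<le> H * \<bar>x - y\<bar> powr \<alpha>" and \<alpha>: "0 < \<alpha>" and H: "0 \<le> H"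
    and M: "\<And>x. \<bar>u (frac x)\<bar> \<le> M" and I: "(LINT x|circle_leb. u x) = 0" and e: "0 < e"
  obtains w where "\<And>x y. \<bar>w (frac x) - w (frac y)\<bar> \<le> 2 * M / e * \<bar>x - y\<bar>" "circle_cont w"
    "(LINT x|circle_leb. w x) = 0" "\<And>x. \<bar>w (frac x) - u (frac x)\<bar> \<le> H * e powr \<alpha>"
proof -
  define q where "q x = u (frac x)" for x
  have q_cont: "continuous_on UNIV q"
    using circle_cont_of_modulus[of u H \<alpha>] u \<alpha> by (simp add: circle_cont_def q_def[abs_def])
  obtain U where U: "\<And>x. (U has_real_derivative q x) (at x)"
    using antiderivative_real[OF q_cont] by blast
  have U_cont: "continuous_on S U" for S
    using U DERIV_isCont by (blast intro: continuous_at_imp_continuous_on)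
  obtain V where V: "\<And>x. (V has_real_derivative U x) (at x)"
    using antiderivative_real[OF U_cont] by blast
  define w where "w x = (U (x + e) - U x) / e" for x
  have "(LINT x|circle_leb. q x) = (LINT x|circle_leb. u x)"
    by (rule Bochner_Integration.integral_cong) (auto simp: q_def frac_circle)
  then have "U 1 - U 0 = 0"
    using integral_circle_FTC[OF U q_cont] I by simp
  then have U_per: "U (x + 1) = U x" for x
    using shift_increment_constant[OF U, of x] by (simp add: q_def)
  have w_frac: "w (frac x) = w x" for x
    using U_per[of "x + e" for x] by (intro periodic_frac) (simp add: w_def U_per add.assoc add.commute[of 1])
  have U_lip: "\<bar>U x - U y\<bar> \<le> M * \<bar>x - y\<bar>" for x y
    using field_differentiable_bound[of UNIV U q M x y] U M by (simp add: q_def)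
  show thesis
  proof
    fix x y
    have "w x - w y = ((U (x + e) - U (y + e)) - (U x - U y)) / e"
      by (simp add: w_def diff_divide_distrib)
    also have "\<bar>\<dots>\<bar> \<le> (M * \<bar>x - y\<bar> + M * \<bar>x - y\<bar>) / e"
      using U_lip[of "x + e" "y + e"] U_lip[of x y] e by (simp add: divide_right_mono)
    finally show "\<bar>w (frac x) - w (frac y)\<bar> \<le> 2 * M / e * \<bar>x - y\<bar>"
      by (simp add: w_frac)
  next
    have w_cont: "continuous_on UNIV w"
      unfolding w_def using e
      by (intro continuous_intros U_cont continuous_on_compose2[OF U_cont[of UNIV]]) auto
    then show "circle_cont w" by (simp add: circle_cont_def w_frac)
    have "((\<lambda>x. (V (x + e) - V x) / e) has_real_derivative w x) (at x)" for x
      unfolding w_def using V[of "x + e"]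
      by (intro DERIV_cdivide DERIV_diff V) (simp add: DERIV_shift)
    from integral_circle_FTC[OF this w_cont]
    have "(LINT x|circle_leb. w x) = ((V (e + 1) - V e) - (V 1 - V 0)) / e"
      by (simp add: add.commute diff_divide_distrib)
    then show "(LINT x|circle_leb. w x) = 0"
      using shift_increment_constant[OF V, of e] U_per by simp
  next
    fix x
    obtain z where z: "x < z" "z < x + e" "U (x + e) - U x = (x + e - x) * q z"
      using MVT2[of x "x + e" U q] U e by auto
    then have "w x = q z" using e by (simp add: w_def)
    then have "\<bar>w x - u (frac x)\<bar> \<le> H * \<bar>z - x\<bar> powr \<alpha>" using u[of z x] by (simp add: q_def)
    also have "\<dots> \<le> H * e powr \<alpha>" using z \<alpha> H by (intro mult_left_mono powr_mono2) auto
    finally show "\<bar>w (frac x) - u (frac x)\<bar> \<le> H * e powr \<alpha>" by (simp add: w_frac)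
  qed
qed

section \<open>Decay along a sequence with small uncoupled mass\<close>

context circle_cocycle
begin

text \<open>
  The mollification is Lipschitz, so its memory is lost at the rate of the uncoupled mass; the error of the
  approximation does not grow, because the transfer operators contract the \<open>L\<^sup>1\<close> norm.
\<close>

lemma memory_loss_mollified:
  fixes u :: "real \<Rightarrow> real"
  assumes d: "0 < d" "d < 1"
    and u: "\<And>x y. \<bar>u (frac x) - u (frac y)\<bar> \<le> H * \<bar>x - y\<bar> powr \<alpha>" and \<alpha>: "0 < \<alpha>" and H: "0 \<le> H"
    and M: "\<And>x. \<bar>u (frac x)\<bar> \<le> M" and I: "(LINT x|circle_leb. u x) = 0" and e: "0 < e"
  shows "(LINT x|circle_leb. \<bar>compose_transfer T \<omega> n u x\<bar>) \<le> 8 * M / e * P d n + H * e powr \<alpha>"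
proof -
  have u_cont: "circle_cont u" using circle_cont_of_modulus[of u H \<alpha>] u \<alpha> by simp
  have M0: "0 \<le> M" using M[of 0] by linarith
  show ?thesis
  proof (cases "M = 0")
    case True
    then have "(LINT x|circle_leb. \<bar>u x\<bar>) = (LINT x|circle_leb. 0)"
      using M by (intro Bochner_Integration.integral_cong) (auto simp: frac_circle dest: frac_circle[symmetric], metis frac_circle)
    then show ?thesis
      using order_trans[OF L1_contraction[OF u_cont, of n], of "H * e powr \<alpha>"] True H by simp
  next
    case False
    with M0 have M_pos: "0 < M" by simp
    obtain w where w: "\<And>x y. \<bar>w (frac x) - w (frac y)\<bar> \<le> 2 * M / e * \<bar>x - y\<bar>" "circle_cont w"
      "(LINT x|circle_leb. w x) = 0" "\<And>x. \<bar>w (frac x) - u (frac x)\<bar> \<le> H * e powr \<alpha>"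
      using mollify[OF u \<alpha> H M I e] by blast
    have wu: "circle_cont (\<lambda>x. w x - u x)"
      using w(2) u_cont unfolding circle_cont_def by (intro continuous_intros)
    have "compose_transfer T \<omega> n u
        = (\<lambda>x. compose_transfer T \<omega> n w x - compose_transfer T \<omega> n (\<lambda>x. w x - u x) x)"
      unfolding compose_transfer_diff[symmetric] by simp
    then have "(LINT x|circle_leb. \<bar>compose_transfer T \<omega> n u x\<bar>)
        \<le> (LINT x|circle_leb. \<bar>compose_transfer T \<omega> n w x\<bar> + \<bar>compose_transfer T \<omega> n (\<lambda>x. w x - u x) x\<bar>)"
      by (intro integral_mono Bochner_Integration.integrable_add integrable_abs circle_cont_integrable
          compose_transfer_cont u_cont w wu) (simp add: abs_triangle_ineq4)
    also have "\<dots> = (LINT x|circle_leb. \<bar>compose_transfer T \<omega> n w x\<bar>)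
        + (LINT x|circle_leb. \<bar>compose_transfer T \<omega> n (\<lambda>x. w x - u x) x\<bar>)"
      by (intro Bochner_Integration.integral_add integrable_abs circle_cont_integrable compose_transfer_cont w wu)
    also have "(LINT x|circle_leb. \<bar>compose_transfer T \<omega> n w x\<bar>) \<le> 4 * (2 * M / e) * P d n"
      using M_pos e by (intro memory_loss_lipschitz d w) auto
    also have "(LINT x|circle_leb. \<bar>compose_transfer T \<omega> n (\<lambda>x. w x - u x) x\<bar>) \<le> (LINT x|circle_leb. \<bar>w x - u x\<bar>)"
      by (rule L1_contraction[OF wu])
    also have "\<dots> \<le> (LINT x|circle_leb. H * e powr \<alpha>)"
    proof (intro integral_mono integrable_abs circle_cont_integrable wu)
      fix x assume "x \<in> space circle_leb"
      then show "\<bar>w x - u x\<bar> \<le> H * e powr \<alpha>" using w(4)[of x] by (simp add: frac_circle)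
    qed (simp add: circle_cont_def)
    finally show ?thesis by simp
  qed
qed

text \<open>
  The window length \<open>e = s ^ n\<close> balances the two terms of \<open>memory_loss_mollified\<close>: the Lipschitz constant of order
  \<open>1 / e\<close> uses up one of the two factors \<open>s ^ n\<close>, and the other one is at most \<open>e powr \<alpha>\<close>, the order of the error.
\<close>

lemma memory_loss_holder:
  fixes u :: "real \<Rightarrow> real"
  assumes d: "0 < d" "d < 1" and s: "0 < s" "s < 1"
    and P: "P d n \<le> S * (s ^ n * s ^ n)"
    and u: "\<And>x y. \<bar>u (frac x) - u (frac y)\<bar> \<le> H * \<bar>x - y\<bar> powr \<alpha>" and \<alpha>: "0 < \<alpha>" "\<alpha> < 1" and H: "0 \<le> H"
    and M: "\<And>x. \<bar>u (frac x)\<bar> \<le> M" and I: "(LINT x|circle_leb. u x) = 0"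
  shows "(LINT x|circle_leb. \<bar>compose_transfer T \<omega> n u x\<bar>) \<le> (8 * S + 1) * (H + M) * s powr (\<alpha> * real n)"
proof -
  define e where "e = s ^ n"
  have e: "0 < e" using s by (simp add: e_def)
  have M0: "0 \<le> M" using M[of 0] by linarith
  have S0: "0 \<le> S"
  proof -
    have "0 \<le> S * (s ^ n * s ^ n)" using P P_nonneg[OF d, of n] by linarith
    moreover have "0 < s ^ n * s ^ n" using s by simp
    ultimately show ?thesis by (simp only: zero_le_mult_iff) auto
  qed
  have e_powr: "e powr \<alpha> = s powr (\<alpha> * real n)"
    using s by (simp add: e_def powr_realpow[symmetric] powr_powr mult.commute)
  have "e \<le> e powr \<alpha>"
  proof -
    have "e powr 1 \<le> e powr \<alpha>"
      using s \<alpha> e by (intro powr_mono') (auto simp: e_def power_le_one)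
    then show ?thesis using e by simp
  qed
  have "(LINT x|circle_leb. \<bar>compose_transfer T \<omega> n u x\<bar>) \<le> 8 * M / e * P d n + H * e powr \<alpha>"
    by (rule memory_loss_mollified[OF d u \<alpha>(1) H M I e])
  also have "8 * M / e * P d n \<le> 8 * M / e * (S * (e * e))"
    using P M0 e by (intro mult_left_mono) (auto simp: e_def)
  also have "8 * M / e * (S * (e * e)) = 8 * S * M * e" using e by simp
  also have "8 * S * M * e \<le> 8 * S * M * e powr \<alpha>"
    using S0 M0 \<open>e \<le> e powr \<alpha>\<close> by (intro mult_left_mono) auto
  also have "8 * S * M * e powr \<alpha> + H * e powr \<alpha> \<le> (8 * S + 1) * (H + M) * e powr \<alpha>"
  proof -
    have "8 * S * M + H \<le> (8 * S + 1) * (H + M)"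
      using S0 M0 H by (simp add: algebra_simps)
    from mult_right_mono[OF this, of "e powr \<alpha>"] show ?thesis by (simp add: algebra_simps)
  qed
  finally show ?thesis by (simp add: e_powr)
qed

lemma memory_loss_densities:
  assumes d: "0 < d" "d < 1" and s: "0 < s" "s < 1" and P: "P d n \<le> S * (s ^ n * s ^ n)"
    and \<alpha>: "0 < \<alpha>" "\<alpha> < 1"
    and dens: "prob_density \<psi>1" "prob_density \<psi>2" and hol: "holder \<alpha> \<psi>1" "holder \<alpha> \<psi>2"
    and S0: "0 \<le> S"
  shows "L1_norm (compose_transfer T \<omega> n (\<lambda>x. \<psi>1 x - \<psi>2 x))
    \<le> 8 * (8 * S + 1) * max (holder_norm \<alpha> \<psi>1) (holder_norm \<alpha> \<psi>2) * s powr (\<alpha> * real n)"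
proof -
  let ?u = "\<lambda>x. \<psi>1 x - \<psi>2 x"
  let ?H = "holder_const \<alpha> \<psi>1 + holder_const \<alpha> \<psi>2" and ?M = "sup_norm \<psi>1 + sup_norm \<psi>2"
  note cont = holder_cont[OF hol(1) \<alpha>(1)] holder_cont[OF hol(2) \<alpha>(1)]
  have nonneg: "0 \<le> ?H" "0 \<le> ?M"
    using hol norm_le_sup_norm[OF cont(1), of 0] norm_le_sup_norm[OF cont(2), of 0]
    by (auto intro!: add_nonneg_nonneg holder_const_nonneg)
  have "L1_norm (compose_transfer T \<omega> n ?u) = (LINT x|circle_leb. \<bar>compose_transfer T \<omega> n ?u x\<bar>)"
    by (simp add: L1_norm_def)
  also have "\<dots> \<le> (8 * S + 1) * (?H + ?M) * s powr (\<alpha> * real n)"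
  proof (rule memory_loss_holder[OF d s P _ \<alpha>])
    fix x y
    show "\<bar>?u (frac x) - ?u (frac y)\<bar> \<le> ?H * \<bar>x - y\<bar> powr \<alpha>"
      using holder_bound_lift[OF hol(1) \<alpha>(1), of x y] holder_bound_lift[OF hol(2) \<alpha>(1), of x y]
      by (simp add: distrib_right abs_le_iff)
    show "\<bar>?u (frac x)\<bar> \<le> ?M"
      using norm_le_sup_norm[OF cont(1), of x] norm_le_sup_norm[OF cont(2), of x]
      by (simp add: abs_le_iff)
  next
    show "(LINT x|circle_leb. ?u x) = 0" using dens by (simp add: prob_density_def)
  qed (use nonneg in auto)
  also have "\<dots> \<le> (8 * S + 1) * (8 * max (holder_norm \<alpha> \<psi>1) (holder_norm \<alpha> \<psi>2)) * s powr (\<alpha> * real n)"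
  proof (intro mult_right_mono mult_left_mono)
    show "?H + ?M \<le> 8 * max (holder_norm \<alpha> \<psi>1) (holder_norm \<alpha> \<psi>2)"
    proof -
      define m where "m = max (holder_norm \<alpha> \<psi>1) (holder_norm \<alpha> \<psi>2)"
      have "holder_norm \<alpha> \<psi>1 \<le> m" "holder_norm \<alpha> \<psi>2 \<le> m" by (simp_all add: m_def)
      then show ?thesis
        unfolding m_def[symmetric] using nonneg unfolding holder_norm_def by linarith
    qed
  qed (use S0 in auto)
  finally show ?thesis by (simp only: mult_ac)
qed

lemma norm_integral_compose_maps_le:
  fixes u :: "real \<Rightarrow> real" and g :: "real \<Rightarrow> 'b::{banach, second_countable_topology}"
  assumes u: "circle_cont u" and g: "g \<in> borel_measurable circle_leb"
    and M: "AE x in circle_leb. norm (g x) \<le> M"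
  shows "norm (LINT x|circle_leb. u x *\<^sub>R g (compose_maps T \<omega> n x))
    \<le> (LINT x|circle_leb. \<bar>compose_transfer T \<omega> n u x\<bar>) * M"
proof -
  note cont = compose_transfer_cont[OF u, of n]
  have "norm (LINT x|circle_leb. u x *\<^sub>R g (compose_maps T \<omega> n x))
      \<le> (LINT x|circle_leb. norm (compose_transfer T \<omega> n u x *\<^sub>R g x))"
    unfolding duality(1)[OF u g M] by (rule integral_norm_bound)
  also have "\<dots> \<le> (LINT x|circle_leb. \<bar>compose_transfer T \<omega> n u x\<bar> * M)"
    using M
    by (intro integral_mono_AE integrable_norm integrable_cont_scaleR_AE_bounded[OF cont g M]
        integrable_mult_left integrable_abs circle_cont_integrable[OF cont])
      (auto elim!: eventually_mono intro: mult_left_mono)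
  finally show ?thesis by simp
qed

end

lemma Linf_AE_bound:
  assumes g: "Linf g"
  shows "AE x in circle_leb. norm (g x) \<le> Linf_norm g" and "0 \<le> Linf_norm g"
proof -
  have fin: "esssup circle_leb (\<lambda>x. ereal (norm (g x))) < \<infinity>" using g by (simp add: Linf_def)
  have "AE x in circle_leb. ereal (norm (g x)) \<le> esssup circle_leb (\<lambda>x. ereal (norm (g x)))"
    by (rule esssup_AE)
  then show 1: "AE x in circle_leb. norm (g x) \<le> Linf_norm g"
    using fin unfolding Linf_norm_def
    by (cases "esssup circle_leb (\<lambda>x. ereal (norm (g x)))") (auto elim!: eventually_mono)
  then have "AE x in circle_leb. 0 \<le> Linf_norm g"
    by (rule eventually_mono) (rule order_trans[OF norm_ge_zero])
  then show "0 \<le> Linf_norm g" by simp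
qed

context circle_cocycle
begin

text \<open>
  The difference of integrals is the integral of \<open>b\<close> times \<open>g\<close> composed with the maps, where \<open>b = (f - c) \<psi>\<close> and
  \<open>c\<close> is the mean of \<open>f\<close> with respect to \<open>\<nu>\<close>. Since \<open>b\<close> has integral zero, duality bounds this by the \<open>L\<^sup>1\<close> norms of the
  transferred real and imaginary parts \<open>p\<close> and \<open>q\<close> of \<open>b\<close>.
\<close>

lemma correlation_decay:
  fixes f g :: "real \<Rightarrow> complex"
  assumes d: "0 < d" "d < 1" and s: "0 < s" "s < 1" and P: "P d n \<le> S * (s ^ n * s ^ n)"
    and \<alpha>: "0 < \<alpha>" "\<alpha> < 1" and S0: "0 \<le> S"
    and dens: "prob_density \<psi>" and hol: "holder \<alpha> \<psi>" "holder \<alpha> f" and g: "Linf g"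
  defines "\<nu> \<equiv> density circle_leb (\<lambda>x. ennreal (\<psi> x))"
  shows "norm ((LINT x|\<nu>. f x * g (compose_maps T \<omega> n x))
        - (LINT x|\<nu>. f x) * (LINT x|\<nu>. g (compose_maps T \<omega> n x)))
    \<le> 8 * (8 * S + 1) * holder_norm \<alpha> \<psi> * holder_norm \<alpha> f * Linf_norm g * s powr (\<alpha> * real n)"
proof -
  define gT where "gT = (\<lambda>x. g (compose_maps T \<omega> n x))"
  note cont = holder_cont[OF hol(1) \<alpha>(1)] holder_cont[OF hol(2) \<alpha>(1)]
  have g_meas: "g \<in> borel_measurable circle_leb" using g by (simp add: Linf_def)
  note g_bound = Linf_AE_bound[OF g]
  have gT_meas: "gT \<in> borel_measurable circle_leb"
    unfolding gT_def using measurable_comp[OF compose_maps_measurable g_meas] by (simp add: comp_def)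
  note [measurable] = g_meas gT_meas circle_cont_measurable[OF cont(1)] circle_cont_measurable[OF cont(2)]
  have \<psi>_nn: "0 \<le> \<psi> (frac x)" for x using dens by (simp add: prob_density_def)
  have \<psi>_AE: "AE x in circle_leb. 0 \<le> \<psi> x" using dens by (auto simp: prob_density_def intro!: AE_I2)
  have nu: "(LINT x|\<nu>. h x) = (LINT x|circle_leb. \<psi> x *\<^sub>R h x)" if "h \<in> borel_measurable circle_leb"
    for h :: "real \<Rightarrow> complex"
    unfolding \<nu>_def using that \<psi>_AE by (intro integral_density) auto
  define a where "a x = \<psi> x *\<^sub>R f x" for x
  define c where "c = (LINT x|circle_leb. a x)"
  have a_cont: "circle_cont a"
    using cont unfolding a_def circle_cont_def by (intro continuous_intros)
  have part_cont: "circle_cont (\<lambda>x. Re (a x))" "circle_cont (\<lambda>x. Im (a x))"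
    using a_cont unfolding circle_cont_def by (intro continuous_intros; simp)+
  define p where "p x = Re (a x) - Re c * \<psi> x" for x
  define q where "q x = Im (a x) - Im c * \<psi> x" for x
  have pq_cont: "circle_cont p" "circle_cont q"
    using part_cont cont unfolding circle_cont_def p_def q_def
    by (auto intro!: continuous_on_diff continuous_on_mult_left)
  have int: "integrable circle_leb (\<lambda>x. u x *\<^sub>R gT x)" if "circle_cont u" for u :: "real \<Rightarrow> real"
    unfolding gT_def by (rule duality(2)[OF that g_meas g_bound(1)])
  define Sf Sp Hf Hp where "Sf = sup_norm f" "Sp = sup_norm \<psi>" "Hf = holder_const \<alpha> f" "Hp = holder_const \<alpha> \<psi>"
  have f_le: "norm (f (frac x)) \<le> Sf" and \<psi>_le: "\<bar>\<psi> (frac x)\<bar> \<le> Sp" for x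
    using norm_le_sup_norm[OF cont(2), of x] norm_le_sup_norm[OF cont(1), of x] by (auto simp: Sf_Sp_Hf_Hp_def)
  have nn: "0 \<le> Sf" "0 \<le> Sp" "0 \<le> Hf" "0 \<le> Hp"
    using order_trans[OF norm_ge_zero f_le[of 0]] order_trans[OF abs_ge_zero \<psi>_le[of 0]]
      holder_const_nonneg hol by (auto simp: Sf_Sp_Hf_Hp_def)
  have c_le: "norm c \<le> Sf"
  proof -
    have "norm c \<le> (LINT x|circle_leb. norm (a x))"
      unfolding c_def by (rule integral_norm_bound)
    also have "\<dots> \<le> (LINT x|circle_leb. \<psi> x * Sf)"
    proof (intro integral_mono integrable_norm integrable_mult_left circle_cont_integrable a_cont cont)
      fix x assume "x \<in> space circle_leb"
      then show "norm (a x) \<le> \<psi> x * Sf"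
        using f_le[of x] \<psi>_nn[of x] by (simp add: a_def frac_circle mult_left_mono)
    qed
    also have "\<dots> = Sf" using dens by (simp add: prob_density_def)
    finally show ?thesis .
  qed
  define b where "b x = a x - c * of_real (\<psi> x)" for x
  have pb: "p x = Re (b x)" and qb: "q x = Im (b x)" for x
    by (simp_all add: p_def q_def b_def)
  define Hb where "Hb = Sp * Hf + 2 * Sf * Hp"
  have b_hol: "norm (b (frac x) - b (frac y)) \<le> Hb * \<bar>x - y\<bar> powr \<alpha>" for x y
  proof -
    let ?D = "\<bar>x - y\<bar> powr \<alpha>"
    have hf: "norm (f (frac x) - f (frac y)) \<le> Hf * ?D"
      and hp: "\<bar>\<psi> (frac x) - \<psi> (frac y)\<bar> \<le> Hp * ?D"
      using holder_bound_lift[OF hol(2) \<alpha>(1), of x y] holder_bound_lift[OF hol(1) \<alpha>(1), of x y]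
      by (auto simp: Sf_Sp_Hf_Hp_def)
    have "b (frac x) - b (frac y) = \<psi> (frac x) *\<^sub>R (f (frac x) - f (frac y))
        + (\<psi> (frac x) - \<psi> (frac y)) *\<^sub>R (f (frac y) - c)"
      by (simp add: b_def a_def scaleR_conv_of_real algebra_simps)
    then have "norm (b (frac x) - b (frac y)) \<le> \<bar>\<psi> (frac x)\<bar> * norm (f (frac x) - f (frac y))
        + \<bar>\<psi> (frac x) - \<psi> (frac y)\<bar> * norm (f (frac y) - c)"
      using norm_triangle_ineq by (metis norm_scaleR)
    also have "\<dots> \<le> Sp * (Hf * ?D) + (Hp * ?D) * (Sf + Sf)"
      using hf hp \<psi>_le[of x] f_le[of y] c_le nn norm_triangle_ineq4[of "f (frac y)" c]
      by (intro add_mono mult_mono) auto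
    finally show ?thesis by (simp add: Hb_def algebra_simps)
  qed
  have b_le: "norm (b (frac x)) \<le> 2 * Sf * Sp" for x
  proof -
    have "b (frac x) = \<psi> (frac x) *\<^sub>R (f (frac x) - c)"
      by (simp add: b_def a_def scaleR_conv_of_real algebra_simps)
    then have "norm (b (frac x)) = \<bar>\<psi> (frac x)\<bar> * norm (f (frac x) - c)" by simp
    also have "\<dots> \<le> Sp * (Sf + Sf)"
      using \<psi>_le[of x] f_le[of x] c_le nn norm_triangle_ineq4[of "f (frac x)" c]
      by (intro mult_mono) auto
    finally show ?thesis by (simp add: mult_ac)
  qed
  have Hb0: "0 \<le> Hb" using nn by (simp add: Hb_def)
  have int0: "(LINT x|circle_leb. p x) = 0" "(LINT x|circle_leb. q x) = 0"
    using dens circle_cont_integrable[OF a_cont] circle_cont_integrable[OF part_cont(1)]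
      circle_cont_integrable[OF part_cont(2)] circle_cont_integrable[OF cont(1)]
    by (simp_all add: p_def q_def c_def prob_density_def integral_Re integral_Im)
  have decay: "(LINT x|circle_leb. \<bar>compose_transfer T \<omega> n u x\<bar>) \<le> (8 * S + 1) * (Hb + 2 * Sf * Sp) * s powr (\<alpha> * real n)"
    if "u = p \<or> u = q" for u
  proof (rule memory_loss_holder[OF d s P _ \<alpha> Hb0])
    fix x y
    show "\<bar>u (frac x) - u (frac y)\<bar> \<le> Hb * \<bar>x - y\<bar> powr \<alpha>"
      using that b_hol[of x y] abs_Re_le_cmod[of "b (frac x) - b (frac y)"] abs_Im_le_cmod[of "b (frac x) - b (frac y)"]
      by (auto simp: pb qb)
    show "\<bar>u (frac x)\<bar> \<le> 2 * Sf * Sp"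
      using that b_le[of x] abs_Re_le_cmod[of "b (frac x)"] abs_Im_le_cmod[of "b (frac x)"]
      by (auto simp: pb qb)
  qed (use that int0 in auto)
  let ?B = "(8 * S + 1) * (Hb + 2 * Sf * Sp) * s powr (\<alpha> * real n)"
  have split: "\<psi> x *\<^sub>R (f x * gT x) = Re (a x) *\<^sub>R gT x + \<i> * (Im (a x) *\<^sub>R gT x)" for x
  proof -
    have "\<psi> x *\<^sub>R (f x * gT x) = a x * gT x" by (simp add: a_def)
    also have "\<dots> = (of_real (Re (a x)) + \<i> * of_real (Im (a x))) * gT x" by (simp only: complex_eq[symmetric])
    finally show ?thesis by (simp add: scaleR_conv_of_real algebra_simps)
  qed
  have int1: "integrable circle_leb (\<lambda>x. \<psi> x *\<^sub>R (f x * gT x))"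
    unfolding split by (intro Bochner_Integration.integrable_add integrable_mult_right int part_cont)
  have "(LINT x|\<nu>. f x * gT x) - (LINT x|\<nu>. f x) * (LINT x|\<nu>. gT x)
      = (LINT x|circle_leb. \<psi> x *\<^sub>R (f x * gT x)) - c * (LINT x|circle_leb. \<psi> x *\<^sub>R gT x)"
    by (simp add: nu c_def a_def)
  also have "\<dots> = (LINT x|circle_leb. \<psi> x *\<^sub>R (f x * gT x) - c * (\<psi> x *\<^sub>R gT x))"
    by (subst Bochner_Integration.integral_diff[OF int1 integrable_mult_right[OF int[OF cont(1)]]])
      (simp only: integral_mult_right_zero)
  also have "\<dots> = (LINT x|circle_leb. p x *\<^sub>R gT x + \<i> * (q x *\<^sub>R gT x))"
  proof (rule Bochner_Integration.integral_cong)
    fix x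
    have "c * (\<psi> x *\<^sub>R gT x) = (of_real (Re c) + \<i> * of_real (Im c)) * (\<psi> x *\<^sub>R gT x)"
      by (simp only: complex_eq[symmetric])
    then show "\<psi> x *\<^sub>R (f x * gT x) - c * (\<psi> x *\<^sub>R gT x) = p x *\<^sub>R gT x + \<i> * (q x *\<^sub>R gT x)"
      unfolding split by (simp add: p_def q_def scaleR_conv_of_real algebra_simps)
  qed simp
  also have "\<dots> = (LINT x|circle_leb. p x *\<^sub>R gT x) + \<i> * (LINT x|circle_leb. q x *\<^sub>R gT x)"
    unfolding Bochner_Integration.integral_add[OF int[OF pq_cont(1)] integrable_mult_right[OF int[OF pq_cont(2)]]]
    by (simp only: integral_mult_right_zero)
  finally have "norm ((LINT x|\<nu>. f x * gT x) - (LINT x|\<nu>. f x) * (LINT x|\<nu>. gT x))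
      \<le> norm (LINT x|circle_leb. p x *\<^sub>R gT x) + norm (LINT x|circle_leb. q x *\<^sub>R gT x)"
    by (simp add: norm_triangle_le norm_mult)
  also have "\<dots> \<le> ?B * Linf_norm g + ?B * Linf_norm g"
    using norm_integral_compose_maps_le[OF pq_cont(1) g_meas g_bound(1), of n]
      norm_integral_compose_maps_le[OF pq_cont(2) g_meas g_bound(1), of n]
      mult_right_mono[OF decay[of p] g_bound(2)] mult_right_mono[OF decay[of q] g_bound(2)]
    unfolding gT_def by (intro add_mono) auto
  also have "\<dots> = 2 * (8 * S + 1) * (Hb + 2 * Sf * Sp) * (Linf_norm g * s powr (\<alpha> * real n))"
    by (simp add: algebra_simps)
  also have "\<dots> \<le> 2 * (8 * S + 1) * (4 * ((Hp + Sp) * (Hf + Sf))) * (Linf_norm g * s powr (\<alpha> * real n))"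
  proof (intro mult_right_mono mult_left_mono)
    have "0 \<le> Hp * Hf" "0 \<le> Sp * Hf" "0 \<le> Sf * Hp" "0 \<le> Sf * Sp" using nn by auto
    then show "Hb + 2 * Sf * Sp \<le> 4 * ((Hp + Sp) * (Hf + Sf))"
      unfolding Hb_def by (simp add: algebra_simps)
  qed (use S0 g_bound(2) in auto)
  also have "\<dots> = 8 * (8 * S + 1) * (Hp + Sp) * (Hf + Sf) * Linf_norm g * s powr (\<alpha> * real n)"
    by (simp add: algebra_simps)
  finally show ?thesis
    by (simp only: gT_def holder_norm_def Sf_Sp_Hf_Hp_def)
qed

end

section \<open>Measurability of expansion and distortion\<close>

lemma circle_dist_frac_near:
  assumes "\<bar>p - q\<bar> \<le> 1 / 2"
  shows "circle_dist (frac p) (frac q) = \<bar>p - q\<bar>"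
proof -
  define d where "d = frac p - frac q"
  define m where "m = \<lfloor>p\<rfloor> - \<lfloor>q\<rfloor>"
  have eq: "p - q = d + of_int m" by (simp add: d_def m_def frac_def)
  have d: "\<bar>d\<bar> < 1"
    unfolding d_def using frac_ge_0[of p] frac_lt_1[of p] frac_ge_0[of q] frac_lt_1[of q] by linarith
  have "\<bar>real_of_int m\<bar> < 2" using eq d assms by linarith
  then have "m = 0 \<or> m = 1 \<or> m = -1" by linarith
  then show ?thesis
    unfolding circle_dist_def d_def[symmetric] eq using eq d assms by (auto simp: min_def)
qed

text \<open>
  Only values of the map enter the left-hand side, not the lift, which need not depend measurably on the map.
\<close>

lemma (in circle_covering) abs_deriv_LIMSEQ:
  "(\<lambda>m. real (Suc m) * circle_dist (T (frac (x + 1 / real (Suc m)))) (T (frac x))) \<longlonglongrightarrow> \<bar>deriv F x\<bar>"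
proof -
  have lim0: "filterlim (\<lambda>m. 1 / real (Suc m)) (at 0) sequentially"
    unfolding filterlim_at using LIMSEQ_inverse_real_of_nat by (simp add: inverse_eq_divide)
  have "(\<lambda>m. (F (x + 1 / real (Suc m)) - F x) / (1 / real (Suc m))) \<longlonglongrightarrow> deriv F x"
    using filterlim_compose[OF deriv_F[of x, unfolded DERIV_def] lim0] by simp
  then have 1: "(\<lambda>m. real (Suc m) * \<bar>F (x + 1 / real (Suc m)) - F x\<bar>) \<longlonglongrightarrow> \<bar>deriv F x\<bar>"
  proof -
    have "\<bar>y / (1 / real (Suc m))\<bar> = real (Suc m) * \<bar>y\<bar>" for y m
      by (simp add: abs_mult mult.commute)
    from tendsto_rabs[OF \<open>_ \<longlonglongrightarrow> deriv F x\<close>, unfolded this] show ?thesis .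
  qed
  have "(\<lambda>m. F (x + 1 / real (Suc m))) \<longlonglongrightarrow> F (x + 0)"
  proof (rule isCont_tendsto_compose[of _ F])
    show "isCont F (x + 0)" using deriv_F DERIV_isCont by blast
    show "(\<lambda>m. x + 1 / real (Suc m)) \<longlonglongrightarrow> x + 0"
      using LIMSEQ_inverse_real_of_nat by (intro tendsto_add tendsto_const) (simp add: inverse_eq_divide)
  qed
  then have "\<forall>\<^sub>F m in sequentially. dist (F (x + 1 / real (Suc m))) (F x) < 1 / 2"
    unfolding tendsto_iff add_0_right by (elim allE[of _ "1 / 2"]) simp
  then have "\<forall>\<^sub>F m in sequentially. real (Suc m) * \<bar>F (x + 1 / real (Suc m)) - F x\<bar>
      = real (Suc m) * circle_dist (T (frac (x + 1 / real (Suc m)))) (T (frac x))"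
    by (rule eventually_mono) (simp add: T_frac circle_dist_frac_near dist_real_def)
  then show ?thesis by (rule Lim_transform_eventually[OF 1])
qed

text \<open>
  The distortion at a point is the derivative of \<open>ln (F'\<^sup>2)\<close> divided by \<open>2 * \<bar>F'\<bar>\<close>, up to sign, and so it is a limit of
  expressions in the measurable quantities \<open>\<bar>F'\<bar>\<close>.
\<close>

lemma (in circle_covering) abs_deriv2_LIMSEQ:
  "(\<lambda>m. \<bar>real (Suc m) * (ln (\<bar>deriv F (x + 1 / real (Suc m))\<bar>\<^sup>2) - ln (\<bar>deriv F x\<bar>\<^sup>2))\<bar> / (2 * \<bar>deriv F x\<bar>))
    \<longlonglongrightarrow> \<bar>deriv (deriv F) x / (deriv F x)\<^sup>2\<bar>"
proof -
  have lim0: "filterlim (\<lambda>m. 1 / real (Suc m)) (at 0) sequentially"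
    unfolding filterlim_at using LIMSEQ_inverse_real_of_nat by (simp add: inverse_eq_divide)
  have pos: "0 < deriv F x * deriv F x"
    by (metis no_crit not_real_square_gt_zero)
  have "((\<lambda>y. ln ((deriv F y)\<^sup>2)) has_real_derivative 2 * deriv (deriv F) x / deriv F x) (at x)"
    using no_crit[of x]
    by (auto intro!: derivative_eq_intros deriv_F' pos simp: power2_eq_square field_simps)
  then have "(\<lambda>m. (ln ((deriv F (x + 1 / real (Suc m)))\<^sup>2) - ln ((deriv F x)\<^sup>2)) / (1 / real (Suc m)))
      \<longlonglongrightarrow> 2 * deriv (deriv F) x / deriv F x"
    unfolding DERIV_def by (rule filterlim_compose[OF _ lim0])
  from tendsto_divide[OF tendsto_rabs[OF this] tendsto_const[of "2 * \<bar>deriv F x\<bar>"]] no_crit[of x]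
  have "(\<lambda>m. \<bar>(ln ((deriv F (x + 1 / real (Suc m)))\<^sup>2) - ln ((deriv F x)\<^sup>2)) / (1 / real (Suc m))\<bar> / (2 * \<bar>deriv F x\<bar>))
      \<longlonglongrightarrow> \<bar>2 * deriv (deriv F) x / deriv F x\<bar> / (2 * \<bar>deriv F x\<bar>)"
    by simp
  moreover have "\<bar>2 * deriv (deriv F) x / deriv F x\<bar> / (2 * \<bar>deriv F x\<bar>) = \<bar>deriv (deriv F) x / (deriv F x)\<^sup>2\<bar>"
    by (simp add: abs_mult abs_divide power2_eq_square)
  ultimately show ?thesis by (simp add: mult.commute)
qed

lemma circle_nonempty: "circle \<noteq> {}"
  using frac_in_circle by blast

lemma le_all_if_le_rat:
  fixes h :: "real \<Rightarrow> real"
  assumes h: "continuous_on UNIV h" and le: "\<And>r. h (of_rat r) \<le> c"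
  shows "h x \<le> c"
proof -
  have "closed {x. h x \<le> c}" using h by (intro closed_Collect_le continuous_on_const)
  moreover have "\<rat> \<subseteq> {x. h x \<le> c}" using le by (auto elim!: Rats_cases)
  ultimately have "closure \<rat> \<subseteq> {x. h x \<le> c}" by (intro closure_minimal)
  then show ?thesis by (auto simp: Rats_closure_real)
qed

text \<open>
  The setting in which the infimum and the supremum over the circle are measurable functions of the map: by continuity
  they are determined by the rational points.
\<close>

locale random_circle_covering = prob_space \<eta> for \<eta> :: "'w measure" +
  fixes T :: "'w \<Rightarrow> real \<Rightarrow> real"
  assumes covering: "w \<in> space \<eta> \<Longrightarrow> \<exists>F. circle_covering (T w) F"
    and joint_measurable: "(\<lambda>(w, x). T w x) \<in> (\<eta> \<Otimes>\<^sub>M circle_borel) \<rightarrow>\<^sub>M circle_borel"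
begin

lemma eval_measurable: "(\<lambda>w. T w (frac x)) \<in> borel_measurable \<eta>"
proof -
  have "(\<lambda>w. (w, frac x)) \<in> \<eta> \<rightarrow>\<^sub>M \<eta> \<Otimes>\<^sub>M circle_borel"
    by (intro measurable_Pair measurable_const measurable_ident_sets) (auto simp: circle_borel_def space_restrict_space)
  from measurable_compose[OF this joint_measurable] show ?thesis
    unfolding circle_borel_def by (simp add: measurable_restrict_space2_iff)
qed

lemma abs_deriv_measurable: "(\<lambda>w. \<bar>circle_deriv (T w) x\<bar>) \<in> borel_measurable \<eta>"
proof (rule borel_measurable_LIMSEQ_real)
  fix w assume "w \<in> space \<eta>"
  then obtain F where "circle_covering (T w) F" using covering by blast
  then interpret circle_covering "T w" F .
  show "(\<lambda>m. real (Suc m) * circle_dist (T w (frac (x + 1 / real (Suc m)))) (T w (frac x)))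
      \<longlonglongrightarrow> \<bar>circle_deriv (T w) x\<bar>"
    using abs_deriv_LIMSEQ by (simp add: circle_deriv)
next
  note [measurable] = eval_measurable
  show "(\<lambda>w. real (Suc m) * circle_dist (T w (frac (x + 1 / real (Suc m)))) (T w (frac x))) \<in> borel_measurable \<eta>" for m
    unfolding circle_dist_def by measurable
qed

lemma distortion_at_measurable:
  "(\<lambda>w. \<bar>circle_deriv2 (T w) x / (circle_deriv (T w) x)\<^sup>2\<bar>) \<in> borel_measurable \<eta>"
proof (rule borel_measurable_LIMSEQ_real)
  let ?a = "\<lambda>w x. \<bar>circle_deriv (T w) x\<bar>"
  fix w assume "w \<in> space \<eta>"
  then obtain F where "circle_covering (T w) F" using covering by blast
  then interpret circle_covering "T w" F .
  show "(\<lambda>m. \<bar>real (Suc m) * (ln ((?a w (x + 1 / real (Suc m)))\<^sup>2) - ln ((?a w x)\<^sup>2))\<bar> / (2 * ?a w x))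
      \<longlonglongrightarrow> \<bar>circle_deriv2 (T w) x / (circle_deriv (T w) x)\<^sup>2\<bar>"
    unfolding circle_deriv circle_deriv2 by (rule abs_deriv2_LIMSEQ)
next
  note [measurable] = abs_deriv_measurable
  show "(\<lambda>w. \<bar>real (Suc m) * (ln (\<bar>circle_deriv (T w) (x + 1 / real (Suc m))\<bar>\<^sup>2)
      - ln (\<bar>circle_deriv (T w) x\<bar>\<^sup>2))\<bar> / (2 * \<bar>circle_deriv (T w) x\<bar>)) \<in> borel_measurable \<eta>" for m
    by measurable
qed

lemma min_expansion_measurable: "(\<lambda>w. min_expansion (T w)) \<in> borel_measurable \<eta>"
  unfolding borel_measurable_iff_ge
proof
  fix c :: real
  have "c \<le> min_expansion (T w) \<longleftrightarrow> (\<forall>r::rat. c \<le> \<bar>circle_deriv (T w) (of_rat r)\<bar>)" if w: "w \<in> space \<eta>" for w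
  proof -
    obtain F where "circle_covering (T w) F" using covering[OF w] by blast
    then interpret circle_covering "T w" F .
    show ?thesis
      unfolding circle_deriv
    proof safe
      show "c \<le> \<bar>deriv F (of_rat r)\<bar>" if "c \<le> min_expansion (T w)" for r
        using that min_expansion_le by (rule order_trans)
      assume "\<forall>r. c \<le> \<bar>deriv F (of_rat r)\<bar>"
      then have rat: "- \<bar>deriv F (of_rat r)\<bar> \<le> - c" for r by simp
      have cont: "continuous_on UNIV (\<lambda>x. - \<bar>deriv F x\<bar>)"
        by (intro continuous_intros cont_F')
      have "c \<le> \<bar>deriv F x\<bar>" for x
        using le_all_if_le_rat[OF cont rat, of x] by simp
      then show "c \<le> min_expansion (T w)"
        unfolding min_expansion_def circle_deriv by (rule cINF_greatest[OF circle_nonempty])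
    qed
  qed
  then have "{w \<in> space \<eta>. c \<le> min_expansion (T w)}
      = {w \<in> space \<eta>. \<forall>r::rat. c \<le> \<bar>circle_deriv (T w) (of_rat r)\<bar>}" by auto
  also have "\<dots> \<in> sets \<eta>"
    using abs_deriv_measurable by (intro sets.sets_Collect_countable_All borel_measurable_le measurable_const) auto
  finally show "{w \<in> space \<eta>. c \<le> min_expansion (T w)} \<in> sets \<eta>" .
qed

lemma distortion_measurable: "(\<lambda>w. distortion (T w)) \<in> borel_measurable \<eta>"
  unfolding borel_measurable_iff_le
proof
  fix c :: real
  have "distortion (T w) \<le> c \<longleftrightarrow>
      (\<forall>r::rat. \<bar>circle_deriv2 (T w) (of_rat r) / (circle_deriv (T w) (of_rat r))\<^sup>2\<bar> \<le> c)" if w: "w \<in> space \<eta>" for w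
  proof -
    obtain F where "circle_covering (T w) F" using covering[OF w] by blast
    then interpret circle_covering "T w" F .
    show ?thesis
      unfolding circle_deriv circle_deriv2
    proof safe
      show "\<bar>deriv (deriv F) (of_rat r) / (deriv F (of_rat r))\<^sup>2\<bar> \<le> c" if "distortion (T w) \<le> c" for r
        using distortion_ge that by (rule order_trans)
      assume rat: "\<forall>r. \<bar>deriv (deriv F) (of_rat r) / (deriv F (of_rat r))\<^sup>2\<bar> \<le> c"
      have cont: "continuous_on UNIV (\<lambda>x. \<bar>deriv (deriv F) x / (deriv F x)\<^sup>2\<bar>)"
        using no_crit by (intro continuous_intros cont_F' cont_F'') simp
      have "\<bar>deriv (deriv F) x / (deriv F x)\<^sup>2\<bar> \<le> c" for x
        using le_all_if_le_rat[OF cont rat[rule_format], of x] .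
      then show "distortion (T w) \<le> c"
        unfolding distortion_def sup_norm_def circle_deriv circle_deriv2 real_norm_def
        by (rule cSUP_least[OF circle_nonempty])
    qed
  qed
  then have "{w \<in> space \<eta>. distortion (T w) \<le> c}
      = {w \<in> space \<eta>. \<forall>r::rat. \<bar>circle_deriv2 (T w) (of_rat r) / (circle_deriv (T w) (of_rat r))\<^sup>2\<bar> \<le> c}" by auto
  also have "\<dots> \<in> sets \<eta>"
    using distortion_at_measurable by (intro sets.sets_Collect_countable_All borel_measurable_le measurable_const) auto
  finally show "{w \<in> space \<eta>. distortion (T w) \<le> c} \<in> sets \<eta>" .
qed

end

section \<open>Exponential decay of the uncoupled mass\<close>

text \<open>
  For \<open>z\<close> above a threshold \<open>R\<close> the affine map \<open>a * z + D\<close> alone decreases \<open>1 + \<kappa> * z\<close> by a factor. Below \<open>R\<close> the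
  first factor is at most \<open>q < 1\<close>, and \<open>\<kappa>\<close> is so small that the growth \<open>1 + \<kappa> * D\<close> of the second one uses up at most half of the
  gap \<open>1 - q\<close>.
\<close>

lemma lyapunov_constants:
  fixes a D d :: real
  assumes a: "0 \<le> a" "a < 1" and D: "0 \<le> D" and d: "0 < d" "d < 1"
  shows "\<exists>\<kappa> \<rho>. 0 < \<kappa> \<and> 0 < \<rho> \<and> \<rho> < 1 \<and>
    (\<forall>z\<ge>0. (1 - d * exp (- z)) * (1 + \<kappa> * (a * z + D)) \<le> \<rho> * (1 + \<kappa> * z))"
proof -
  define R where "R = 2 * (D + 1) / (1 - a)"
  define q where "q = 1 - d * exp (- R)"
  have R: "0 < R" using a D by (simp add: R_def)
  have q: "0 < q" "q < 1"
  proof -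
    have "d * exp (- R) < 1 * 1" using d R by (intro mult_strict_mono) auto
    then show "0 < q" "q < 1" using d by (simp_all add: q_def)
  qed
  define \<kappa> where "\<kappa> = (1 - q) / (2 * (D + 1))"
  have \<kappa>: "0 < \<kappa>" using q D by (simp add: \<kappa>_def)
  define s where "s = min (1 / 2) (min \<kappa> ((1 - a) / 2))"
  have s: "0 < s" "s < 1" "s \<le> \<kappa>" "s \<le> (1 - a) / 2"
  proof -
    have "0 < (1 - a) / 2" using a by simp
    then show "0 < s" using \<kappa> unfolding s_def by simp
    show "s < 1" "s \<le> \<kappa>" "s \<le> (1 - a) / 2" unfolding s_def by linarith+
  qed
  define \<rho> where "\<rho> = max ((1 + q) / 2) (1 - s)"
  have \<rho>: "0 < \<rho>" "\<rho> < 1" "(1 + q) / 2 \<le> \<rho>" "1 - s \<le> \<rho>" using q s by (auto simp: \<rho>_def)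
  have "(1 - d * exp (- z)) * (1 + \<kappa> * (a * z + D)) \<le> \<rho> * (1 + \<kappa> * z)" if z: "0 \<le> z" for z
  proof (cases "R \<le> z")
    case True
    have pos: "0 \<le> 1 + \<kappa> * (a * z + D)" using \<kappa> a z D by simp
    have "(1 - d * exp (- z)) * (1 + \<kappa> * (a * z + D)) \<le> 1 * (1 + \<kappa> * (a * z + D))"
      using pos d by (intro mult_right_mono) auto
    moreover have "2 * (D + 1) \<le> (1 - a) * z"
      using True a by (simp add: R_def field_simps)
    then have "a * z + D \<le> z - ((1 - a) / 2 * z + 1)" by (simp add: field_simps)
    then have "\<kappa> * (a * z + D) \<le> \<kappa> * (z - ((1 - a) / 2 * z + 1))"
      using \<kappa> by (intro mult_left_mono) auto
    moreover have "s * (1 + \<kappa> * z) \<le> \<kappa> * ((1 - a) / 2 * z + 1)"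
    proof -
      have "s * (\<kappa> * z) \<le> (1 - a) / 2 * (\<kappa> * z)" using s \<kappa> z by (intro mult_right_mono) auto
      moreover have "\<kappa> * ((1 - a) / 2 * z + 1) = (1 - a) / 2 * (\<kappa> * z) + \<kappa>"
        by (simp add: distrib_left)
      moreover have "s * (1 + \<kappa> * z) = s + s * (\<kappa> * z)" by (simp add: distrib_left)
      ultimately show ?thesis using s(3) by linarith
    qed
    moreover have "(1 - s) * (1 + \<kappa> * z) \<le> \<rho> * (1 + \<kappa> * z)"
      using \<rho> \<kappa> z by (intro mult_right_mono) auto
    ultimately show ?thesis by (simp add: algebra_simps)
  next
    case False
    have "1 - d * exp (- z) \<le> q" using False d by (simp add: q_def)
    moreover have "1 + \<kappa> * (a * z + D) \<le> (1 + \<kappa> * z) * (1 + \<kappa> * D)"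
    proof -
      have "a * z \<le> 1 * z" using a z by (intro mult_right_mono) auto
      then have "\<kappa> * (a * z + D) \<le> \<kappa> * (z + D)" using \<kappa> by (intro mult_left_mono) auto
      moreover have "0 \<le> \<kappa> * z * (\<kappa> * D)" using \<kappa> z D by simp
      ultimately show ?thesis by (simp add: algebra_simps)
    qed
    ultimately have "(1 - d * exp (- z)) * (1 + \<kappa> * (a * z + D)) \<le> q * ((1 + \<kappa> * z) * (1 + \<kappa> * D))"
      using q \<kappa> a z D by (intro mult_mono) auto
    also have "\<dots> = (q + q * (\<kappa> * D)) * (1 + \<kappa> * z)" by (simp add: algebra_simps)
    also have "\<dots> \<le> \<rho> * (1 + \<kappa> * z)"
    proof (intro mult_right_mono)
      have "\<kappa> * D \<le> (1 - q) / 2"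
        using q D by (simp add: \<kappa>_def divide_simps mult_left_mono)
      moreover have "q * (\<kappa> * D) \<le> 1 * (\<kappa> * D)" using q \<kappa> D by (intro mult_right_mono) auto
      ultimately show "q + q * (\<kappa> * D) \<le> \<rho>" using \<rho> by (simp add: field_simps)
    qed (use \<kappa> z in auto)
    finally show ?thesis .
  qed
  then show ?thesis using \<kappa> \<rho> by blast
qed

lemma regularity_cong:
  "(\<And>i. 1 \<le> i \<Longrightarrow> i \<le> n \<Longrightarrow> \<omega> i = \<omega>' i) \<Longrightarrow> regularity d a D \<omega> n = regularity d a D \<omega>' n"
  by (induction n) auto

lemma uncoupled_mass_cong:
  "(\<And>i. 1 \<le> i \<Longrightarrow> i \<le> n \<Longrightarrow> \<omega> i = \<omega>' i) \<Longrightarrow> uncoupled_mass d a D \<omega> n = uncoupled_mass d a D \<omega>' n"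
  by (induction n) (auto simp: regularity_cong[of _ \<omega> \<omega>'])

lemma regularity_measurable:
  assumes [measurable]: "a \<in> borel_measurable M" "D \<in> borel_measurable M" and "{1..n} \<subseteq> I"
  shows "(\<lambda>\<omega>. regularity d a D \<omega> n) \<in> borel_measurable (PiM I (\<lambda>_. M))"
  using assms(3)
proof (induction n)
  case (Suc n)
  have "{1..n} \<subseteq> I" using Suc.prems by (auto simp: subset_iff)
  then have [measurable]: "(\<lambda>\<omega>. regularity d a D \<omega> n) \<in> borel_measurable (PiM I (\<lambda>_. M))" by (rule Suc.IH)
  have [measurable]: "(\<lambda>\<omega>. \<omega> (Suc n)) \<in> PiM I (\<lambda>_. M) \<rightarrow>\<^sub>M M"
    using Suc.prems by (intro measurable_component_singleton) auto
  show ?case by simp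
qed simp

lemma uncoupled_mass_measurable:
  assumes [measurable]: "a \<in> borel_measurable M" "D \<in> borel_measurable M" and "{1..n} \<subseteq> I"
  shows "(\<lambda>\<omega>. uncoupled_mass d a D \<omega> n) \<in> borel_measurable (PiM I (\<lambda>_. M))"
  using assms(3)
proof (induction n)
  case (Suc n)
  have "{1..n} \<subseteq> I" using Suc.prems by (auto simp: subset_iff)
  then have [measurable]: "(\<lambda>\<omega>. uncoupled_mass d a D \<omega> n) \<in> borel_measurable (PiM I (\<lambda>_. M))"
    "(\<lambda>\<omega>. regularity d a D \<omega> n) \<in> borel_measurable (PiM I (\<lambda>_. M))"
    by (rule Suc.IH, rule regularity_measurable[OF assms(1,2)])
  show ?case by simp
qed simp

context prob_space
begin

lemma uncoupled_mass_step_expectation: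
  fixes a D :: "'a \<Rightarrow> real"
  assumes [measurable]: "a \<in> borel_measurable M" "D \<in> borel_measurable M"
    and nn: "\<And>w. w \<in> space M \<Longrightarrow> 0 \<le> a w" "\<And>w. w \<in> space M \<Longrightarrow> 0 \<le> D w"
    and A: "(\<integral>\<^sup>+ w. ennreal (a w) \<partial>M) = ennreal A" "0 \<le> A" and B: "(\<integral>\<^sup>+ w. ennreal (D w) \<partial>M) = ennreal B" "0 \<le> B"
    and c: "0 \<le> p" "0 \<le> z" "0 \<le> \<kappa>"
  shows "(\<integral>\<^sup>+ w. ennreal (p * (1 + \<kappa> * (z * a w + D w))) \<partial>M) = ennreal (p * (1 + \<kappa> * (z * A + B)))"
proof -
  have "(\<integral>\<^sup>+ w. ennreal (p * (1 + \<kappa> * (z * a w + D w))) \<partial>M)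
      = (\<integral>\<^sup>+ w. ennreal p + ennreal (p * \<kappa> * z) * ennreal (a w) + ennreal (p * \<kappa>) * ennreal (D w) \<partial>M)"
    using c nn by (intro nn_integral_cong) (simp add: ennreal_mult'[symmetric] ennreal_plus[symmetric] algebra_simps del: ennreal_plus)
  also have "\<dots> = ennreal p + ennreal (p * \<kappa> * z) * ennreal A + ennreal (p * \<kappa>) * ennreal B"
    by (simp add: nn_integral_add nn_integral_cmult A B emeasure_space_1)
  also have "\<dots> = ennreal (p * (1 + \<kappa> * (z * A + B)))"
    using c A B by (simp add: ennreal_mult'[symmetric] ennreal_plus[symmetric] algebra_simps del: ennreal_plus)
  finally show ?thesis .
qed

text \<open>
  Given the first \<open>n\<close> maps, the next one is independent of the current \<open>Z\<close> and \<open>P\<close>, and averaging over it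
  replaces \<open>a\<close> and \<open>D\<close> by their means; the hypothesis \<open>lyap\<close> then yields one factor \<open>\<rho>\<close>.
\<close>

lemma expectation_uncoupled_mass:
  fixes a D :: "'a \<Rightarrow> real"
  assumes meas: "a \<in> borel_measurable M" "D \<in> borel_measurable M"
    and nn: "\<And>w. w \<in> space M \<Longrightarrow> 0 \<le> a w" "\<And>w. w \<in> space M \<Longrightarrow> 0 \<le> D w"
    and A: "(\<integral>\<^sup>+ w. ennreal (a w) \<partial>M) = ennreal A" "0 \<le> A" and B: "(\<integral>\<^sup>+ w. ennreal (D w) \<partial>M) = ennreal B" "0 \<le> B"
    and d: "0 < d" "d < 1" and \<kappa>: "0 < \<kappa>" and \<rho>: "0 < \<rho>"
    and lyap: "\<And>z. 0 \<le> z \<Longrightarrow> (1 - d * exp (- z)) * (1 + \<kappa> * (A / (1 - d) * z + B)) \<le> \<rho> * (1 + \<kappa> * z)"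
  shows "(\<integral>\<^sup>+ \<omega>. ennreal (uncoupled_mass d a D \<omega> n * (1 + \<kappa> * regularity d a D \<omega> n)) \<partial>PiM {1..n} (\<lambda>_. M))
    \<le> ennreal (\<rho> ^ n * (1 + \<kappa>))"
proof (induction n)
  case 0
  interpret product_prob_space "\<lambda>_::nat. M" "{}" by standard
  show ?case by (simp add: PiM_empty)
next
  case (Suc n)
  interpret product_sigma_finite "\<lambda>_::nat. M" by standard
  let ?Z = "regularity d a D" and ?P = "uncoupled_mass d a D"
  have set_eq: "{1..Suc n} = insert (Suc n) {1..n}" by auto
  have "(\<integral>\<^sup>+ \<omega>. ennreal (?P \<omega> (Suc n) * (1 + \<kappa> * ?Z \<omega> (Suc n))) \<partial>PiM {1..Suc n} (\<lambda>_. M))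
      = (\<integral>\<^sup>+ \<omega>. (\<integral>\<^sup>+ w. ennreal (?P (fun_upd \<omega> (Suc n) w) (Suc n) * (1 + \<kappa> * ?Z (fun_upd \<omega> (Suc n) w) (Suc n))) \<partial>M) \<partial>PiM {1..n} (\<lambda>_. M))"
    unfolding set_eq
  proof (rule product_nn_integral_insert)
    have [measurable]: "(\<lambda>\<omega>. ?Z \<omega> (Suc n)) \<in> borel_measurable (PiM (insert (Suc n) {1..n}) (\<lambda>_. M))"
      "(\<lambda>\<omega>. ?P \<omega> (Suc n)) \<in> borel_measurable (PiM (insert (Suc n) {1..n}) (\<lambda>_. M))"
      by (intro regularity_measurable uncoupled_mass_measurable meas; auto)+
    show "(\<lambda>\<omega>. ennreal (?P \<omega> (Suc n) * (1 + \<kappa> * ?Z \<omega> (Suc n)))) \<in> borel_measurable (PiM (insert (Suc n) {1..n}) (\<lambda>_. M))"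
      by measurable
  qed auto
  also have "\<dots> \<le> (\<integral>\<^sup>+ \<omega>. ennreal \<rho> * ennreal (?P \<omega> n * (1 + \<kappa> * ?Z \<omega> n)) \<partial>PiM {1..n} (\<lambda>_. M))"
  proof (rule nn_integral_mono)
    fix \<omega> assume "\<omega> \<in> space (PiM {1..n} (\<lambda>_. M))"
    then have \<omega>: "\<omega> i \<in> space M" if "1 \<le> i" "i \<le> n" for i
      using that by (auto simp: space_PiM)
    let ?z = "?Z \<omega> n" and ?p = "?P \<omega> n"
    have z: "0 \<le> ?z" and p: "0 \<le> ?p"
      using \<omega> nn d by (auto intro!: regularity_nonneg uncoupled_mass_nonneg)
    have le1: "d * exp (- ?z) \<le> 1"
      using d z by (rule coupling_fraction_le_one)
    have cong: "?Z (fun_upd \<omega> (Suc n) w) n = ?z" "?P (fun_upd \<omega> (Suc n) w) n = ?p" for w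
      by (auto intro!: regularity_cong uncoupled_mass_cong)
    have "(\<integral>\<^sup>+ w. ennreal (?P (fun_upd \<omega> (Suc n) w) (Suc n) * (1 + \<kappa> * ?Z (fun_upd \<omega> (Suc n) w) (Suc n))) \<partial>M)
        = (\<integral>\<^sup>+ w. ennreal ((?p * (1 - d * exp (- ?z))) * (1 + \<kappa> * (?z / (1 - d) * a w + D w))) \<partial>M)"
      by (simp add: cong)
    also have "\<dots> = ennreal ((?p * (1 - d * exp (- ?z))) * (1 + \<kappa> * (?z / (1 - d) * A + B)))"
      using p le1 z d \<kappa> by (intro uncoupled_mass_step_expectation meas nn A B) auto
    also have "\<dots> \<le> ennreal (\<rho> * (?p * (1 + \<kappa> * ?z)))"
      using mult_left_mono[OF lyap[OF z] p] by (intro ennreal_leI) (simp add: mult_ac)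
    also have "\<dots> = ennreal \<rho> * ennreal (?p * (1 + \<kappa> * ?z))"
      using \<rho> by (intro ennreal_mult') auto
    finally show "(\<integral>\<^sup>+ w. ennreal (?P (fun_upd \<omega> (Suc n) w) (Suc n) * (1 + \<kappa> * ?Z (fun_upd \<omega> (Suc n) w) (Suc n))) \<partial>M)
        \<le> ennreal \<rho> * ennreal (?p * (1 + \<kappa> * ?z))" .
  qed
  also have "\<dots> = ennreal \<rho> * (\<integral>\<^sup>+ \<omega>. ennreal (?P \<omega> n * (1 + \<kappa> * ?Z \<omega> n)) \<partial>PiM {1..n} (\<lambda>_. M))"
  proof (rule nn_integral_cmult)
    have [measurable]: "(\<lambda>\<omega>. ?Z \<omega> n) \<in> borel_measurable (PiM {1..n} (\<lambda>_. M))"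
      "(\<lambda>\<omega>. ?P \<omega> n) \<in> borel_measurable (PiM {1..n} (\<lambda>_. M))"
      by (intro regularity_measurable uncoupled_mass_measurable meas; auto)+
    show "(\<lambda>\<omega>. ennreal (?P \<omega> n * (1 + \<kappa> * ?Z \<omega> n))) \<in> borel_measurable (PiM {1..n} (\<lambda>_. M))" by measurable
  qed
  also have "\<dots> \<le> ennreal \<rho> * ennreal (\<rho> ^ n * (1 + \<kappa>))"
    by (intro mult_left_mono Suc.IH) auto
  also have "\<dots> = ennreal (\<rho> ^ Suc n * (1 + \<kappa>))"
    using \<rho> by (simp add: ennreal_mult'[symmetric] mult_ac)
  finally show ?case .
qed

text \<open>
  With \<open>r\<^sup>2 = \<rho>\<close>, the expectation of \<open>P\<^sub>n / r\<^sup>n\<close> is of order \<open>r\<^sup>n\<close>, so the series of these quotients has finite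
  expectation; its sum bounds each of its terms.
\<close>

lemma AE_uncoupled_mass_decay:
  fixes a D :: "'a \<Rightarrow> real"
  assumes meas: "a \<in> borel_measurable M" "D \<in> borel_measurable M"
    and nn: "\<And>w. w \<in> space M \<Longrightarrow> 0 \<le> a w" "\<And>w. w \<in> space M \<Longrightarrow> 0 \<le> D w"
    and A: "(\<integral>\<^sup>+ w. ennreal (a w) \<partial>M) < 1" and B: "(\<integral>\<^sup>+ w. ennreal (D w) \<partial>M) < \<infinity>"
  shows "\<exists>d r. 0 < d \<and> d < 1 \<and> 0 < r \<and> r < 1 \<and>
    (AE \<omega> in PiM {1::nat..} (\<lambda>_. M). \<exists>S\<ge>0. \<forall>n. uncoupled_mass d a D \<omega> n \<le> S * r ^ n)"
proof -
  obtain A' where A': "(\<integral>\<^sup>+ w. ennreal (a w) \<partial>M) = ennreal A'" "0 \<le> A'"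
    using A by (cases "\<integral>\<^sup>+ w. ennreal (a w) \<partial>M") (auto simp: top_unique)
  obtain B' where B': "(\<integral>\<^sup>+ w. ennreal (D w) \<partial>M) = ennreal B'" "0 \<le> B'"
    using B by (cases "\<integral>\<^sup>+ w. ennreal (D w) \<partial>M") auto
  have A1: "A' < 1" using A A' by (simp add: ennreal_less_iff flip: ennreal_1)
  \<comment> \<open>half of the gap, so that \<open>A' / (1 - d) < 1\<close>\<close>
  define d where "d = (1 - A') / 2"
  have d: "0 < d" "d < 1" using A1 A' by (auto simp: d_def)
  have "A' / (1 - d) < 1" "0 \<le> A' / (1 - d)" using A1 A' d by (auto simp: d_def field_simps)
  then obtain \<kappa> \<rho> where \<kappa>: "0 < \<kappa>" and \<rho>: "0 < \<rho>" "\<rho> < 1"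
    and lyap: "\<And>z. 0 \<le> z \<Longrightarrow> (1 - d * exp (- z)) * (1 + \<kappa> * (A' / (1 - d) * z + B')) \<le> \<rho> * (1 + \<kappa> * z)"
    using lyapunov_constants[of "A' / (1 - d)" B' d] B' d by blast
  define r where "r = sqrt \<rho>"
  have r: "0 < r" "r < 1" "r * r = \<rho>" using \<rho> by (auto simp: r_def)
  note expectation = expectation_uncoupled_mass[OF meas nn A' B' d \<kappa> \<rho>(1) lyap]
  interpret product_prob_space "\<lambda>_::nat. M" "{1..}" by standard
  let ?\<Omega> = "PiM {1::nat..} (\<lambda>_. M)" and ?P = "uncoupled_mass d a D" and ?Z = "regularity d a D"
  have P_meas[measurable]: "(\<lambda>\<omega>. ?P \<omega> n) \<in> borel_measurable ?\<Omega>" for n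
    using uncoupled_mass_measurable[OF meas, of n "{1..}"] by auto
  have E: "(\<integral>\<^sup>+ \<omega>. ennreal (?P \<omega> n) \<partial>?\<Omega>) \<le> ennreal (\<rho> ^ n * (1 + \<kappa>))" for n
  proof -
    have P_meas_n: "(\<lambda>\<omega>. ennreal (?P \<omega> n)) \<in> borel_measurable (PiM {1..n} (\<lambda>_. M))"
      by (intro measurable_compose[OF _ measurable_ennreal] uncoupled_mass_measurable meas order_refl)
    have "(\<integral>\<^sup>+ \<omega>. ennreal (?P \<omega> n) \<partial>?\<Omega>) = (\<integral>\<^sup>+ \<omega>. ennreal (?P (restrict \<omega> {1..n}) n) \<partial>?\<Omega>)"
      by (intro nn_integral_cong arg_cong[where f = ennreal] uncoupled_mass_cong) auto
    also have "\<dots> = (\<integral>\<^sup>+ \<omega>. ennreal (?P \<omega> n) \<partial>distr ?\<Omega> (PiM {1..n} (\<lambda>_. M)) (\<lambda>\<omega>. restrict \<omega> {1..n}))"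
    proof (rule nn_integral_distr[symmetric])
      show "(\<lambda>\<omega>. restrict \<omega> {1..n}) \<in> ?\<Omega> \<rightarrow>\<^sub>M PiM {1..n} (\<lambda>_. M)"
        by (rule measurable_restrict_subset) auto
    qed (simp add: P_meas_n[unfolded One_nat_def])
    also have "\<dots> = (\<integral>\<^sup>+ \<omega>. ennreal (?P \<omega> n) \<partial>PiM {1..n} (\<lambda>_. M))"
      by (subst distr_PiM_restrict_finite) auto
    also have "\<dots> \<le> (\<integral>\<^sup>+ \<omega>. ennreal (?P \<omega> n * (1 + \<kappa> * ?Z \<omega> n)) \<partial>PiM {1..n} (\<lambda>_. M))"
    proof (intro nn_integral_mono)
      fix \<omega> assume "\<omega> \<in> space (PiM {1..n} (\<lambda>_. M))"
      then have \<omega>: "\<omega> i \<in> space M" if "1 \<le> i" "i \<le> n" for i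
        using that by (auto simp: space_PiM)
      have "0 \<le> ?Z \<omega> n" "0 \<le> ?P \<omega> n"
        using \<omega> nn d by (auto intro!: regularity_nonneg uncoupled_mass_nonneg)
      then show "ennreal (?P \<omega> n) \<le> ennreal (?P \<omega> n * (1 + \<kappa> * ?Z \<omega> n))"
        using \<kappa> by (intro ennreal_leI) (simp add: algebra_simps)
    qed
    also have "\<dots> \<le> ennreal (\<rho> ^ n * (1 + \<kappa>))"
      by (rule expectation)
    finally show ?thesis .
  qed
  have "(\<integral>\<^sup>+ \<omega>. (\<Sum>n. ennreal (?P \<omega> n / r ^ n)) \<partial>?\<Omega>) = (\<Sum>n. \<integral>\<^sup>+ \<omega>. ennreal (?P \<omega> n / r ^ n) \<partial>?\<Omega>)"
    by (intro nn_integral_suminf) measurable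
  also have "\<dots> \<le> (\<Sum>n. ennreal ((1 + \<kappa>) * r ^ n))"
  proof (intro suminf_le summableI)
    fix n
    have "(\<integral>\<^sup>+ \<omega>. ennreal (?P \<omega> n / r ^ n) \<partial>?\<Omega>) = (\<integral>\<^sup>+ \<omega>. ennreal (1 / r ^ n) * ennreal (?P \<omega> n) \<partial>?\<Omega>)"
      using r by (intro nn_integral_cong) (simp add: ennreal_mult'[symmetric])
    also have "\<dots> = ennreal (1 / r ^ n) * (\<integral>\<^sup>+ \<omega>. ennreal (?P \<omega> n) \<partial>?\<Omega>)"
      by (intro nn_integral_cmult) measurable
    also have "\<dots> \<le> ennreal (1 / r ^ n) * ennreal (\<rho> ^ n * (1 + \<kappa>))"
      by (intro mult_left_mono E) auto
    also have "\<dots> = ennreal ((1 + \<kappa>) * r ^ n)"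
      using r(1,2) by (simp add: ennreal_mult'[symmetric] r(3)[symmetric] power_mult_distrib mult.commute)
    finally show "(\<integral>\<^sup>+ \<omega>. ennreal (?P \<omega> n / r ^ n) \<partial>?\<Omega>) \<le> ennreal ((1 + \<kappa>) * r ^ n)" .
  qed
  also have "\<dots> < \<infinity>"
  proof -
    have "summable (\<lambda>n. (1 + \<kappa>) * r ^ n)" using r by (intro summable_mult summable_geometric) auto
    then show ?thesis
      using r \<kappa> by (subst suminf_ennreal2) auto
  qed
  finally have fin: "(\<integral>\<^sup>+ \<omega>. (\<Sum>n. ennreal (?P \<omega> n / r ^ n)) \<partial>?\<Omega>) < \<infinity>" .
  have "AE \<omega> in ?\<Omega>. (\<Sum>n. ennreal (?P \<omega> n / r ^ n)) \<noteq> \<infinity>"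
  proof (rule nn_integral_PInf_AE)
    show "(\<lambda>\<omega>. \<Sum>n. ennreal (?P \<omega> n / r ^ n)) \<in> borel_measurable ?\<Omega>" by measurable
  qed (use fin in simp)
  then have "AE \<omega> in ?\<Omega>. \<exists>S\<ge>0. \<forall>n. ?P \<omega> n \<le> S * r ^ n"
  proof (rule eventually_mono)
    fix \<omega> assume "(\<Sum>n. ennreal (?P \<omega> n / r ^ n)) \<noteq> \<infinity>"
    then obtain S where S: "0 \<le> S" "(\<Sum>n. ennreal (?P \<omega> n / r ^ n)) = ennreal S"
      by (cases "\<Sum>n. ennreal (?P \<omega> n / r ^ n)") auto
    have "?P \<omega> n \<le> S * r ^ n" for n
    proof -
      have "sum (\<lambda>n. ennreal (?P \<omega> n / r ^ n)) {n} \<le> (\<Sum>n. ennreal (?P \<omega> n / r ^ n))"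
        by (rule sum_le_suminf) auto
      then have "?P \<omega> n / r ^ n \<le> S" using S by (simp add: ennreal_le_iff)
      then show ?thesis using r by (simp add: field_simps)
    qed
    then show "\<exists>S\<ge>0. \<forall>n. ?P \<omega> n \<le> S * r ^ n" using S by blast
  qed
  then show ?thesis using d r by blast
qed

end

section \<open>Memory loss and mixing for almost every sequence\<close>

text \<open>
  The bounds \<open>a \<le> (1 + a\<^sup>2) / 2\<close> and \<open>D \<le> 1 + D\<^sup>2\<close> turn the integrability assumptions into those on first moments that the
  decay of the uncoupled mass requires. The almost sure event does not depend on \<open>\<alpha>\<close>.
\<close>

theorem theorem3:
  fixes \<eta> :: "'w measure" and T :: "'w \<Rightarrow> real \<Rightarrow> real"
  assumes prob: "prob_space \<eta>"
    and C2: "\<And>w. w \<in> space \<eta> \<Longrightarrow> circle_C2 (T w)"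
    and no_crit: "\<And>w x. w \<in> space \<eta> \<Longrightarrow> x \<in> circle \<Longrightarrow> circle_deriv (T w) x \<noteq> 0"
    and meas: "(\<lambda>(w, x). T w x) \<in> (\<eta> \<Otimes>\<^sub>M circle_borel) \<rightarrow>\<^sub>M circle_borel"
    and expanding: "(\<integral>\<^sup>+ w. ennreal (1 / (min_expansion (T w))\<^sup>2) \<partial>\<eta>) < 1"
    and distortion: "(\<integral>\<^sup>+ w. ennreal ((distortion (T w))\<^sup>2) \<partial>\<eta>) < \<infinity>"
  shows "\<exists>\<theta>::real. 0 < \<theta> \<and> \<theta> < 1 \<and>
    (\<forall>\<alpha>::real. 0 < \<alpha> \<longrightarrow> \<alpha> < 1 \<longrightarrow>
      (AE \<omega> in PiM {1::nat..} (\<lambda>_. \<eta>). \<exists>C::real. 0 < C \<and>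
        (\<forall>(n::nat) (\<psi>1::real \<Rightarrow> real) (\<psi>2::real \<Rightarrow> real).
           prob_density \<psi>1 \<longrightarrow> prob_density \<psi>2 \<longrightarrow> holder \<alpha> \<psi>1 \<longrightarrow> holder \<alpha> \<psi>2 \<longrightarrow>
           L1_norm (compose_transfer T \<omega> n (\<lambda>x. \<psi>1 x - \<psi>2 x))
             \<le> C * max (holder_norm \<alpha> \<psi>1) (holder_norm \<alpha> \<psi>2) * \<theta> powr (\<alpha> * real n)) \<and>
        (\<forall>(n::nat) (\<psi>::real \<Rightarrow> real) (f::real \<Rightarrow> complex) (g::real \<Rightarrow> complex).
           prob_density \<psi> \<longrightarrow> holder \<alpha> \<psi> \<longrightarrow> holder \<alpha> f \<longrightarrow> Linf g \<longrightarrow>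
           (let \<nu> = density circle_leb (\<lambda>x. ennreal (\<psi> x)) in
             norm ((LINT x|\<nu>. f x * g (compose_maps T \<omega> n x))
                   - (LINT x|\<nu>. f x) * (LINT x|\<nu>. g (compose_maps T \<omega> n x)))
               \<le> C * holder_norm \<alpha> \<psi> * holder_norm \<alpha> f * Linf_norm g * \<theta> powr (\<alpha> * real n)))))"
proof -
  interpret \<eta>: prob_space \<eta> by (rule prob)
  have covering: "\<exists>F. circle_covering (T w) F" if w: "w \<in> space \<eta>" for w
  proof -
    obtain F where F: "circle_lift (T w) F" "\<And>x. F differentiable (at x)"
      "\<And>x. deriv F differentiable (at x)" "continuous_on UNIV (deriv (deriv F))"
      using C2[OF w] unfolding circle_C2_def by blast
    have deriv: "circle_deriv (T w) = deriv F" by (rule circle_deriv_eq[OF F(1)])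
    have "deriv F x \<noteq> 0" if "x \<in> circle" for x
      using no_crit[OF w that] by (simp add: deriv)
    with F have "circle_covering (T w) F" by unfold_locales
    then show ?thesis by blast
  qed
  interpret random_circle_covering \<eta> T
    by unfold_locales (use covering meas in auto)
  let ?a = "\<lambda>w. 1 / min_expansion (T w)" and ?D = "\<lambda>w. distortion (T w)"
  have nn: "0 \<le> ?a w" "0 \<le> ?D w" if w: "w \<in> space \<eta>" for w
  proof -
    obtain F where "circle_covering (T w) F" using covering[OF w] by blast
    then interpret circle_covering "T w" F .
    show "0 \<le> ?a w" "0 \<le> ?D w" using min_expansion_pos distortion_nonneg by simp_all
  qed
  note [measurable] = min_expansion_measurable distortion_measurable
  have a_int: "(\<integral>\<^sup>+ w. ennreal (?a w) \<partial>\<eta>) < 1"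
  proof -
    have le: "?a w \<le> 1 / 2 + 1 / 2 * (1 / (min_expansion (T w))\<^sup>2)" for w
    proof -
      have "0 \<le> (1 - ?a w)\<^sup>2" by simp
      then show ?thesis by (simp add: power2_diff power_one_over)
    qed
    have "(\<integral>\<^sup>+ w. ennreal (?a w) \<partial>\<eta>)
        \<le> (\<integral>\<^sup>+ w. ennreal (1 / 2) + ennreal (1 / 2) * ennreal (1 / (min_expansion (T w))\<^sup>2) \<partial>\<eta>)"
    proof (rule nn_integral_mono)
      fix w
      have "ennreal (?a w) \<le> ennreal (1 / 2 + 1 / 2 * (1 / (min_expansion (T w))\<^sup>2))"
        by (rule ennreal_leI[OF le])
      also have "\<dots> = ennreal (1 / 2) + ennreal (1 / 2 * (1 / (min_expansion (T w))\<^sup>2))"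
        by (rule ennreal_plus) simp_all
      also have "ennreal (1 / 2 * (1 / (min_expansion (T w))\<^sup>2)) = ennreal (1 / 2) * ennreal (1 / (min_expansion (T w))\<^sup>2)"
        by (rule ennreal_mult') simp
      finally show "ennreal (?a w) \<le> ennreal (1 / 2) + ennreal (1 / 2) * ennreal (1 / (min_expansion (T w))\<^sup>2)" .
    qed
    also have "\<dots> = ennreal (1 / 2) + ennreal (1 / 2) * (\<integral>\<^sup>+ w. ennreal (1 / (min_expansion (T w))\<^sup>2) \<partial>\<eta>)"
      by (simp add: nn_integral_add nn_integral_cmult \<eta>.emeasure_space_1)
    also have "\<dots> < 1"
    proof -
      obtain I where I: "(\<integral>\<^sup>+ w. ennreal (1 / (min_expansion (T w))\<^sup>2) \<partial>\<eta>) = ennreal I" "0 \<le> I"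
        using expanding by (cases "\<integral>\<^sup>+ w. ennreal (1 / (min_expansion (T w))\<^sup>2) \<partial>\<eta>") (auto simp: top_unique)
      then have "I < 1" using expanding by (simp add: ennreal_less_iff flip: ennreal_1)
      then have "ennreal (1 / 2 + 1 / 2 * I) < ennreal 1"
        using I(2) by (intro ennreal_lessI) auto
      also have "ennreal (1 / 2 + 1 / 2 * I) = ennreal (1 / 2) + ennreal (1 / 2 * I)"
        using I(2) by (intro ennreal_plus) simp_all
      also have "ennreal (1 / 2 * I) = ennreal (1 / 2) * ennreal I"
        by (rule ennreal_mult') simp
      finally show ?thesis by (simp only: I(1) ennreal_1)
    qed
    finally show ?thesis .
  qed
  have D_int: "(\<integral>\<^sup>+ w. ennreal (?D w) \<partial>\<eta>) < \<infinity>"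
  proof -
    have le: "?D w \<le> 1 + (distortion (T w))\<^sup>2" for w
    proof -
      have "0 \<le> (1 - ?D w)\<^sup>2" "0 \<le> (?D w)\<^sup>2" by simp_all
      then show ?thesis by (simp only: power2_diff one_power2)
    qed
    have "(\<integral>\<^sup>+ w. ennreal (?D w) \<partial>\<eta>) \<le> (\<integral>\<^sup>+ w. 1 + ennreal ((distortion (T w))\<^sup>2) \<partial>\<eta>)"
      by (intro nn_integral_mono)
        (use le in \<open>simp add: ennreal_1[symmetric] ennreal_plus[symmetric] ennreal_leI del: ennreal_plus ennreal_1\<close>)
    also have "\<dots> = 1 + (\<integral>\<^sup>+ w. ennreal ((distortion (T w))\<^sup>2) \<partial>\<eta>)"
      by (simp add: nn_integral_add \<eta>.emeasure_space_1)
    also have "\<dots> < \<infinity>" using distortion by simp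
    finally show ?thesis .
  qed
  have a_meas: "?a \<in> borel_measurable \<eta>" by measurable
  obtain d r where d: "0 < d" "d < 1" and r: "0 < r" "r < 1"
    and decay: "AE \<omega> in PiM {1::nat..} (\<lambda>_. \<eta>). \<exists>S\<ge>0. \<forall>n. uncoupled_mass d ?a ?D \<omega> n \<le> S * r ^ n"
    using \<eta>.AE_uncoupled_mass_decay[OF a_meas distortion_measurable nn a_int D_int] by blast
  define \<theta> where "\<theta> = sqrt r"
  have \<theta>: "0 < \<theta>" "\<theta> < 1" "r ^ n = \<theta> ^ n * \<theta> ^ n" for n
    using r by (auto simp: \<theta>_def simp flip: power_mult_distrib)
  show ?thesis
  proof (intro exI[of _ \<theta>] conjI allI impI \<theta>(1,2))
    fix \<alpha> :: real
    assume \<alpha>: "0 < \<alpha>" "\<alpha> < 1"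
    show "AE \<omega> in PiM {1::nat..} (\<lambda>_. \<eta>). \<exists>C::real. 0 < C \<and>
        (\<forall>(n::nat) (\<psi>1::real \<Rightarrow> real) (\<psi>2::real \<Rightarrow> real).
           prob_density \<psi>1 \<longrightarrow> prob_density \<psi>2 \<longrightarrow> holder \<alpha> \<psi>1 \<longrightarrow> holder \<alpha> \<psi>2 \<longrightarrow>
           L1_norm (compose_transfer T \<omega> n (\<lambda>x. \<psi>1 x - \<psi>2 x))
             \<le> C * max (holder_norm \<alpha> \<psi>1) (holder_norm \<alpha> \<psi>2) * \<theta> powr (\<alpha> * real n)) \<and>
        (\<forall>(n::nat) (\<psi>::real \<Rightarrow> real) (f::real \<Rightarrow> complex) (g::real \<Rightarrow> complex).
           prob_density \<psi> \<longrightarrow> holder \<alpha> \<psi> \<longrightarrow> holder \<alpha> f \<longrightarrow> Linf g \<longrightarrow>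
           (let \<nu> = density circle_leb (\<lambda>x. ennreal (\<psi> x)) in
             norm ((LINT x|\<nu>. f x * g (compose_maps T \<omega> n x))
                   - (LINT x|\<nu>. f x) * (LINT x|\<nu>. g (compose_maps T \<omega> n x)))
               \<le> C * holder_norm \<alpha> \<psi> * holder_norm \<alpha> f * Linf_norm g * \<theta> powr (\<alpha> * real n)))"
      using decay AE_space
    proof eventually_elim
      case (elim \<omega>)
      then obtain S where S: "0 \<le> S" "\<And>n. uncoupled_mass d ?a ?D \<omega> n \<le> S * (\<theta> ^ n * \<theta> ^ n)"
        by (auto simp: \<theta>(3))
      have "\<omega> (Suc n) \<in> space \<eta>" for n
        using elim(2) by (auto simp: space_PiM)
      then interpret circle_cocycle T \<omega>
        by unfold_locales (rule covering)
      have "0 < 8 * (8 * S + 1)" using S(1) by simp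
      then show ?case
        unfolding Let_def
        by (intro exI[of _ "8 * (8 * S + 1)"] conjI allI impI
            memory_loss_densities[OF d \<theta>(1,2) S(2) \<alpha> _ _ _ _ S(1)]
            correlation_decay[OF d \<theta>(1,2) S(2) \<alpha> S(1)])
    qed
  qed
qed

end
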